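(* Let $p$ be a prime, $q$ a power of $p$, and $r$ a power of $p$ ($r=p^a$ with an integer $a\ge 1$). Let $\mathbf{m}=(m_j)_{j\ge 0}$ be a sequence of integers with $m_0=1$ and $m_j\ge 2$ for all integers $j\ge 1$. For each integer $j\ge 0$ put $r_j:=r^{m_0m_1\cdots m_j}$ and $\alpha_j(r,\mathbf{m}):=\sum_{n=1}^{\infty}T^{-r_j^n}\in\mathbb{F}_q((T^{-1}))$, where $r_j^n=(r_j)^n$. Then the Laurent series $\xi(r,\mathbf{m}):=\sum_{j=0}^{\infty}\alpha_j(r,\mathbf{m})\in\mathbb{F}_q((T^{-1}))$ is both a $T$-number and a $T^{*}$-number.
   Context: $\mathbb{F}_q$ is the finite field with $q$ elements and $\mathbb{F}_q((T^{-1}))$ is the field of Laurent series in $T^{-1}$ over $\mathbb{F}_q$. For nonzero $\xi=\sum_{n=N}^{\infty}a_nT^{-n}\in\mathbb{F}_q((T^{-1}))$ with $N\in\mathbb{Z}$, $a_n\in\mathbb{F}_q$, $a_N\neq 0$, put $|\xi|:=q^{-N}$, and $|0|:=0$; this absolute value extends uniquely to the algebraic closure of $\mathbb{F}_q((T^{-1}))$, and the extension is also denoted $|\cdot|$. $\overline{\mathbb{F}_q(T)}$ is the algebraic closure of $\mathbb{F}_q(T)$ inside the algebraic closure of $\mathbb{F}_q((T^{-1}))$. Infinite series converge with respect to $|\cdot|$ (the series defining $\xi(r,\mathbf{m})$ converges since $|\alpha_j(r,\mathbf{m})|\to 0$). The height $H(P)$ of a polynomial $P(X)\in(\mathbb{F}_q[T])[X]$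 is the maximum of the absolute values of its coefficients. For $\alpha\in\overline{\mathbb{F}_q(T)}$, its minimal polynomial is the unique non-constant, irreducible, primitive polynomial $P(X)\in(\mathbb{F}_q[T])[X]$ whose leading coefficient is a monic polynomial in $T$ and with $P(\alpha)=0$; the height $H(\alpha)$ and the degree $\deg\alpha$ are the height and the degree (in $X$) of this polynomial. For an integer $n\ge 1$ and $\xi\in\mathbb{F}_q((T^{-1}))$, $w_n(\xi)$ (resp. $w_n^{*}(\xi)$) denotes the supremum in $\mathbb{R}\cup\{+\infty\}$ of the real numbers $w$ (resp. $w^{*}$) such that $0<|P(\xi)|\le H(P)^{-w}$ for infinitely many $P(X)\in(\mathbb{F}_q[T])[X]$ of degree at most $n$ (resp. $0<|\xi-\alpha|\le H(\alpha)^{-w^{*}-1}$ for infinitely many $\alpha\in\overline{\mathbb{F}_q(T)}$ of degree at most $n$). Put $w(\xi):=\limsup_{n\to\infty}w_n(\xi)/n$ and $w^{*}(\xi):=\limsup_{n\to\infty}w_n^{*}(\xi)/n$. $\xi$ is a $T$-number if $w(\xi)=+\infty$ and $w_n(\xi)<+\infty$ for all integers $n\ge 1$; $\xi$ is a $T^{*}$-number if $w^{*}(\xi)=+\infty$ and $w_n^{*}(\xi)<+\infty$ for all integers $n\ge 1$. *)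

theory Defs
  imports
    "HOL-Analysis.Analysis"
    "HOL-Computational_Algebra.Computational_Algebra"
    "HOL-Algebra.Algebraic_Closure_Type"
begin

text \<open>
  A finite field with \<open>q\<close> elements is a type \<^typ>\<open>'a\<close> of sort \<open>{field,finite}\<close> with \<open>CARD('a) = q\<close>.
  The field of Laurent series in \<open>T\<^sup>-\<^sup>1\<close> is \<^typ>\<open>'a fls\<close>, whose variable \<^const>\<open>fls_X\<close> stands for
  \<open>T\<^sup>-\<^sup>1\<close>; hence \<open>T\<close> itself is \<^const>\<open>fls_X_inv\<close>.  In \<^typ>\<open>'a poly poly\<close> the outer variable
  is \<open>X\<close> and the inner one is \<open>T\<close>.
\<close>

definition fls_abs :: "'a::{field,finite} fls \<Rightarrow> real" where
  "fls_abs x = (if x = 0 then 0 else real CARD('a) powi (- fls_subdegree x))"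

definition of_Tpoly :: "'a::{field,finite} poly \<Rightarrow> 'a fls" where
  "of_Tpoly c = poly (map_poly fls_const c) fls_X_inv"

definition eval_fls :: "'a::{field,finite} poly poly \<Rightarrow> 'a fls \<Rightarrow> 'a fls" where
  "eval_fls P x = poly (map_poly of_Tpoly P) x"

definition eval_ac :: "'a::{field,finite} poly poly \<Rightarrow> 'a fls alg_closure \<Rightarrow> 'a fls alg_closure" where
  "eval_ac P \<alpha> = poly (map_poly (\<lambda>c. to_ac (of_Tpoly c)) P) \<alpha>"

text \<open>
  The extension of \<^const>\<open>fls_abs\<close> to the algebraic closure of the Laurent series field exists
  and is unique.  Notions depending on it take it as a parameter \<open>v\<close> that satisfies the
  following predicate.
\<close>

definition extends_fls_abs :: "('a::{field,finite} fls alg_closure \<Rightarrow> real) \<Rightarrow> bool" where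
  "extends_fls_abs v \<longleftrightarrow>
     (\<forall>x. v x \<ge> 0) \<and> (\<forall>x. v x = 0 \<longleftrightarrow> x = 0) \<and>
     (\<forall>x y. v (x * y) = v x * v y) \<and> (\<forall>x y. v (x + y) \<le> v x + v y) \<and>
     (\<forall>x. v (to_ac x) = fls_abs x)"

definition height_poly :: "'a::{field,finite} poly poly \<Rightarrow> real" where
  "height_poly P = (MAX i\<in>{..Polynomial.degree P}. fls_abs (of_Tpoly (Polynomial.coeff P i)))"

definition Tfractions :: "'a::{field,finite} fls alg_closure set" where
  "Tfractions = {to_ac (of_Tpoly a / of_Tpoly b) | a b. b \<noteq> 0}"

definition algebraic_numbers_T :: "'a::{field,finite} fls alg_closure set" where
  "algebraic_numbers_T =
     {\<alpha>. \<exists>f. f \<noteq> 0 \<and> (\<forall>i. Polynomial.coeff f i \<in> Tfractions) \<and> poly f \<alpha> = 0}"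

definition primitive_poly :: "'a::{field,finite} poly poly \<Rightarrow> bool" where
  "primitive_poly P \<longleftrightarrow> (\<forall>d. (\<forall>i. d dvd Polynomial.coeff P i) \<longrightarrow> is_unit d)"

definition is_min_poly :: "'a::{field,finite} fls alg_closure \<Rightarrow> 'a poly poly \<Rightarrow> bool" where
  "is_min_poly \<alpha> P \<longleftrightarrow>
     Polynomial.degree P > 0 \<and> Factorial_Ring.irreducible P \<and> primitive_poly P \<and>
     Polynomial.lead_coeff (Polynomial.lead_coeff P) = 1 \<and> eval_ac P \<alpha> = 0"

definition min_poly :: "'a::{field,finite} fls alg_closure \<Rightarrow> 'a poly poly" where
  "min_poly \<alpha> = (THE P. is_min_poly \<alpha> P)"

definition height_alg :: "'a::{field,finite} fls alg_closure \<Rightarrow> real" where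
  "height_alg \<alpha> = height_poly (min_poly \<alpha>)"

definition degree_alg :: "'a::{field,finite} fls alg_closure \<Rightarrow> nat" where
  "degree_alg \<alpha> = Polynomial.degree (min_poly \<alpha>)"

text \<open>
  The suprema are taken in \<^typ>\<open>ereal\<close>.  The sets are never empty for \<open>n \<ge> 1\<close>, so this agrees
  with the supremum in \<open>\<real> \<union> {+\<infinity>}\<close>.
\<close>

definition w_n :: "nat \<Rightarrow> 'a::{field,finite} fls \<Rightarrow> ereal" where
  "w_n n \<xi> = Sup {ereal w | w.
     infinite {P. Polynomial.degree P \<le> n \<and> 0 < fls_abs (eval_fls P \<xi>) \<and>
                  fls_abs (eval_fls P \<xi>) \<le> height_poly P powr (- w)}}"

definition w_n_star ::
    "('a::{field,finite} fls alg_closure \<Rightarrow> real) \<Rightarrow> nat \<Rightarrow> 'a fls \<Rightarrow> ereal" where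
  "w_n_star v n \<xi> = Sup {ereal w | w.
     infinite {\<alpha>. \<alpha> \<in> algebraic_numbers_T \<and> degree_alg \<alpha> \<le> n \<and>
                  0 < v (to_ac \<xi> - \<alpha>) \<and>
                  v (to_ac \<xi> - \<alpha>) \<le> height_alg \<alpha> powr (- w - 1)}}"

definition w_limsup :: "'a::{field,finite} fls \<Rightarrow> ereal" where
  "w_limsup \<xi> = limsup (\<lambda>n. w_n n \<xi> / ereal (real n))"

definition w_star_limsup :: "('a::{field,finite} fls alg_closure \<Rightarrow> real) \<Rightarrow> 'a fls \<Rightarrow> ereal" where
  "w_star_limsup v \<xi> = limsup (\<lambda>n. w_n_star v n \<xi> / ereal (real n))"

definition T_number :: "'a::{field,finite} fls \<Rightarrow> bool" where
  "T_number \<xi> \<longleftrightarrow> w_limsup \<xi> = \<infinity> \<and> (\<forall>n\<ge>1. w_n n \<xi> < \<infinity>)"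

definition T_star_number :: "('a::{field,finite} fls alg_closure \<Rightarrow> real) \<Rightarrow> 'a fls \<Rightarrow> bool" where
  "T_star_number v \<xi> \<longleftrightarrow> w_star_limsup v \<xi> = \<infinity> \<and> (\<forall>n\<ge>1. w_n_star v n \<xi> < \<infinity>)"

definition r_seq :: "nat \<Rightarrow> (nat \<Rightarrow> nat) \<Rightarrow> nat \<Rightarrow> nat" where
  "r_seq r m j = r ^ (\<Prod>i\<le>j. m i)"

text \<open>
  Infinite sums refer to the library metric on \<^typ>\<open>'a fls\<close>.  That metric uses base \<open>2\<close> instead
  of base \<open>q\<close>, but it induces the same topology as \<^const>\<open>fls_abs\<close>.
\<close>

definition alpha_series :: "nat \<Rightarrow> (nat \<Rightarrow> nat) \<Rightarrow> nat \<Rightarrow> 'a::{field,finite} fls" where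
  "alpha_series r m j = (\<Sum>n. fls_X ^ (r_seq r m j ^ Suc n))"

definition xi_series :: "nat \<Rightarrow> (nat \<Rightarrow> nat) \<Rightarrow> 'a::{field,finite} fls" where
  "xi_series r m = (\<Sum>j. alpha_series r m j)"

end

theory Submission
  imports Defs "HOL-Number_Theory.Residues"
begin

text \<open>
  Write \<open>M\<^sub>j = m\<^sub>0 \<dots> m\<^sub>j\<close> and \<open>N k = #{j. M\<^sub>j dvd k}\<close>; then \<open>\<xi> = \<Sum>\<^sub>k N(k) T\<^bsup>-r^k\<^esup>\<close> with
  coefficients in the prime field.  For \<open>R = r\<^bsup>M_J\<^esup>\<close> the Frobenius shifts the coefficients by \<open>M\<^sub>J\<close>,
  so \<open>\<xi>\<^sup>R - \<xi>\<close> is again such a series, and its coefficients \<open>e\<^sub>k = N(k - M\<^sub>J) - N(k)\<close> vanish for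
  \<open>k > M\<^sub>J\<close> off the multiples of \<open>M\<^sub>J\<close>.

  Truncating \<open>\<xi>\<^sup>R - \<xi>\<close> at \<open>K\<close> to \<open>E\<^sub>K\<close> gives the polynomial \<open>T\<^bsup>r^K\<^esup> (X\<^sup>R - X - E\<^sub>K)\<close> of degree \<open>R\<close>.
  Since the coefficients only matter modulo \<open>p\<close>, there are infinitely many \<open>K\<close> that are followed by
  a gap of length \<open>3 M\<^sub>J\<close>; hence \<open>w\<^sub>R(\<xi>) \<ge> R\<^sup>3 - 1\<close>, and likewise for \<open>w\<^sup>*\<close>, because the polynomial
  has a root in the Laurent series field that is close to \<open>\<xi>\<close>.

  Conversely let \<open>P\<close> have degree at most \<open>n < R\<close>.  A pigeonhole argument yields a nonzero multiple
  of \<open>P\<close> of the form \<open>F(X\<^sup>R - X)\<close> with \<open>F\<close> of degree at most \<open>n\<close> and controlled height.  The truncations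
  of \<open>\<xi>\<^sup>R - \<xi>\<close> are rational approximations with exponent \<open>R > n\<close> and only boundedly growing gaps, so
  Liouville's argument bounds \<open>F(\<xi>\<^sup>R - \<xi>)\<close>, and with it \<open>P(\<xi>)\<close>, from below by a power of the height.
\<close>

unbundle fps_syntax

section \<open>The ultrametric absolute value on Laurent series\<close>

lemma card_finite_field_gt_1: "real CARD('a::{field,finite}) > 1"
proof -
  have "card {0, 1::'a} \<le> CARD('a)" by (rule card_mono) auto
  thus ?thesis by simp
qed

lemma fls_abs_0 [simp]: "fls_abs 0 = 0"
  by (simp add: fls_abs_def)

lemma fls_abs_eq_powr:
  fixes x :: "'a::{field,finite} fls"
  assumes "x \<noteq> 0"
  shows "fls_abs x = real CARD('a) powr (- real_of_int (fls_subdegree x))"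
  using assms card_finite_field_gt_1[where 'a='a]
  by (simp add: fls_abs_def powr_real_of_int' powr_minus power_int_minus)

lemma fls_abs_nonneg [simp]: "0 \<le> fls_abs x"
  by (simp add: fls_abs_def)

lemma fls_abs_1 [simp]: "fls_abs 1 = 1"
  by (simp add: fls_abs_def)

lemma fls_abs_minus [simp]: "fls_abs (- x) = fls_abs x"
  by (simp add: fls_abs_def)

lemma fls_abs_mult: "fls_abs (x * y) = fls_abs x * fls_abs y"
proof (cases "x = 0 \<or> y = 0")
  case False
  thus ?thesis
    using card_finite_field_gt_1[where 'a='a] by (simp add: fls_abs_eq_powr flip: powr_add)
qed auto

lemma fls_abs_power: "fls_abs (x ^ n) = fls_abs x ^ n"
  by (induction n) (simp_all add: fls_abs_mult)

text \<open>Turns a size estimate into the vanishing of coefficients; the zero series is included,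
  so no case split on it is needed later.\<close>

lemma fls_abs_le_iff:
  fixes x :: "'a::{field,finite} fls"
  shows "fls_abs x \<le> real CARD('a) powr (- real_of_int n) \<longleftrightarrow> (\<forall>k<n. x $$ k = 0)"
proof (cases "x = 0")
  case False
  have "fls_abs x \<le> real CARD('a) powr (- real_of_int n) \<longleftrightarrow> n \<le> fls_subdegree x"
    using False card_finite_field_gt_1[where 'a='a] by (simp add: fls_abs_eq_powr)
  also have "\<dots> \<longleftrightarrow> (\<forall>k<n. x $$ k = 0)"
    using False by (auto intro!: fls_subdegree_geI)
  finally show ?thesis .
qed simp

lemma fls_abs_eqI:
  fixes x :: "'a::{field,finite} fls"
  assumes "x $$ n \<noteq> 0" "\<And>k. k < n \<Longrightarrow> x $$ k = 0"
  shows "fls_abs x = real CARD('a) powr (- real_of_int n)"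
proof -
  have "fls_subdegree x = n" using assms by (rule fls_subdegree_eqI)
  moreover have "x \<noteq> 0" using assms(1) by auto
  ultimately show ?thesis by (simp add: fls_abs_eq_powr)
qed

lemma fls_abs_X_inv_power:
  "fls_abs (fls_X_inv ^ n :: 'a::{field,finite} fls) = real CARD('a) powr real n"
  by (simp add: fls_abs_eq_powr)

text \<open>The ultrametric inequality with one common bound \<open>B\<close> instead of a maximum,
  so that it chains as an introduction rule.\<close>

lemma fls_abs_add_le:
  fixes x y :: "'a::{field,finite} fls"
  assumes "fls_abs x \<le> B" "fls_abs y \<le> B"
  shows "fls_abs (x + y) \<le> B"
proof (cases "x = 0 \<or> y = 0 \<or> x + y = 0")
  case False
  have "fls_subdegree (x + y) \<ge> min (fls_subdegree x) (fls_subdegree y)"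
    using False by (intro fls_plus_subdegree) auto
  hence "fls_abs (x + y) \<le> fls_abs x \<or> fls_abs (x + y) \<le> fls_abs y"
    using False card_finite_field_gt_1[where 'a='a]
    by (auto simp: fls_abs_eq_powr min_def split: if_splits)
  thus ?thesis using assms by linarith
next
  case True
  then consider "x = 0" | "y = 0" | "x + y = 0" by blast
  thus ?thesis
    using assms order_trans[OF fls_abs_nonneg[of x] assms(1)] by cases simp_all
qed

lemma fls_abs_diff_le:
  "fls_abs x \<le> B \<Longrightarrow> fls_abs y \<le> B \<Longrightarrow> fls_abs (x - y) \<le> B"
  using fls_abs_add_le[of x B "- y"] by simp

lemma fls_abs_sum_le:
  assumes "0 \<le> B" "\<And>i. i \<in> A \<Longrightarrow> fls_abs (f i) \<le> B"
  shows "fls_abs (sum f A) \<le> B"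
  using assms by (induction A rule: infinite_finite_induct) (auto intro: fls_abs_add_le)

text \<open>Ultrametric triangles are isosceles: in \<open>y = x - (x - y)\<close> the second term
  is too small to account for the size of \<open>y\<close>. This transfers lower bounds from an
  approximation to the limit.\<close>

lemma fls_abs_eq_of_diff_less:
  fixes x y :: "'a::{field,finite} fls"
  assumes "fls_abs (x - y) < fls_abs y"
  shows "fls_abs x = fls_abs y"
proof (rule antisym)
  show "fls_abs x \<le> fls_abs y"
    using fls_abs_add_le[of "x - y" "fls_abs y" y] assms by simp
  have "fls_abs (x - (x - y)) \<le> max (fls_abs x) (fls_abs (x - y))"
    by (intro fls_abs_diff_le max.cobounded1 max.cobounded2)
  hence "fls_abs y \<le> max (fls_abs x) (fls_abs (x - y))" by simp
  thus "fls_abs y \<le> fls_abs x"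
    using assms by linarith
qed

section \<open>Lacunary series\<close>

text \<open>The series of \<open>c k * T^(-r^k)\<close> over \<open>k \<ge> 1\<close>;
  \<open>c 0\<close> is never read. For \<open>r \<ge> 2\<close> one has \<open>k < r^k\<close>, so
  it suffices to search the exponent in \<open>{1..i}\<close>, and at most one summand is
  nonzero.\<close>

definition lac :: "nat \<Rightarrow> (nat \<Rightarrow> 'a) \<Rightarrow> 'a::{field,finite} fls" where
  "lac r c = fps_to_fls (Abs_fps (\<lambda>i. \<Sum>k\<in>{1..i}. if i = r ^ k then c k else 0))"

lemma lac_nth_power:
  assumes "r \<ge> 2" "k \<ge> 1"
  shows "lac r c $$ int (r ^ k) = c k"
proof -
  have "k \<in> {1..r ^ k}" using less_exp[of k] power_mono[of 2 r k] assms by simp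
  moreover have "r ^ k = r ^ j \<longleftrightarrow> k = j" for j using assms by (intro power_inject_exp) auto
  ultimately show ?thesis unfolding lac_def
    by (simp del: of_nat_power add: sum.delta)
qed

lemma lac_nth_eq_0:
  assumes "\<forall>k\<ge>1. n \<noteq> int (r ^ k)"
  shows "lac r c $$ n = 0"
proof (cases "n \<ge> 0")
  case True
  have "(if nat n = r ^ k then c k else 0) = 0" if "k \<in> {1..nat n}" for k
  proof -
    have "n \<noteq> int (r ^ k)" using assms that by auto
    hence "nat n \<noteq> r ^ k" using True by (simp only: nat_eq_iff) auto
    thus ?thesis by simp
  qed
  thus ?thesis using True by (simp add: lac_def)
qed (simp add: lac_def)

lemma lac_nth_cases:
  fixes n :: int
  obtains k where "k \<ge> 1" "n = int (r ^ k)"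
    | "\<forall>k\<ge>1. n \<noteq> int (r ^ k)"
  by blast

lemma lac_add:
  assumes "r \<ge> 2"
  shows "lac r (\<lambda>k. a k + b k) = lac r a + lac r b"
proof (intro fls_eqI)
  fix n show "lac r (\<lambda>k. a k + b k) $$ n = (lac r a + lac r b) $$ n"
    by (cases rule: lac_nth_cases[of n r])
       (simp_all add: lac_nth_power[OF assms] lac_nth_eq_0 del: of_nat_power)
qed

lemma lac_diff:
  assumes "r \<ge> 2"
  shows "lac r (\<lambda>k. a k - b k) = lac r a - lac r b"
proof (intro fls_eqI)
  fix n show "lac r (\<lambda>k. a k - b k) $$ n = (lac r a - lac r b) $$ n"
    by (cases rule: lac_nth_cases[of n r])
       (simp_all add: lac_nth_power[OF assms] lac_nth_eq_0 del: of_nat_power)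
qed

lemma lac_cong:
  assumes "r \<ge> 2" "\<And>k. k \<ge> 1 \<Longrightarrow> a k = b k"
  shows "lac r a = lac r b"
proof (intro fls_eqI)
  fix n show "lac r a $$ n = lac r b $$ n"
    by (cases rule: lac_nth_cases[of n r])
       (simp_all add: lac_nth_power[OF assms(1)] assms(2) lac_nth_eq_0 del: of_nat_power)
qed

lemma lac_finite:
  assumes "r \<ge> 2" "\<And>k. k > K \<Longrightarrow> c k = 0"
  shows "lac r c = (\<Sum>k=1..K. fls_const (c k) * fls_X ^ (r ^ k))"
proof (intro fls_eqI)
  fix n
  have inj: "r ^ k = r ^ j \<longleftrightarrow> k = j" for k j using assms by (intro power_inject_exp) auto
  show "lac r c $$ n = (\<Sum>k=1..K. fls_const (c k) * fls_X ^ (r ^ k)) $$ n"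
  proof (cases rule: lac_nth_cases[of n r])
    case (1 k)
    have "(\<Sum>j=1..K. fls_const (c j) * fls_X ^ (r ^ j)) $$ n =
          (\<Sum>j=1..K. if k = j then c j else 0)"
      unfolding fls_nth_sum by (rule sum.cong) (simp_all add: 1(2) inj del: of_nat_power)
    also have "\<dots> = c k" using 1(1) assms(2)[of k] by auto
    finally show ?thesis using 1 lac_nth_power[OF assms(1) 1(1)] by simp
  next
    case 2
    have "(fls_const (c k) * fls_X ^ (r ^ k)) $$ n = 0" if "k \<in> {1..K}" for k
      using 2 that by (auto simp del: of_nat_power)
    hence "(\<Sum>k=1..K. fls_const (c k) * fls_X ^ (r ^ k)) $$ n = 0"
      unfolding fls_nth_sum by (rule sum.neutral[OF ballI])
    thus ?thesis using lac_nth_eq_0[OF 2, of c] by (simp only:)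
  qed
qed

lemma lac_nth_below:
  assumes "r \<ge> 2" "\<And>k. 1 \<le> k \<Longrightarrow> k < K \<Longrightarrow> c k = 0" "n < int (r ^ K)"
  shows "lac r c $$ n = 0"
proof (cases rule: lac_nth_cases[of n r])
  case (1 k)
  hence "k < K" using assms(1,3) power_less_imp_less_exp[of r k K] by simp
  thus ?thesis using assms(2)[OF 1(1)] lac_nth_power[OF assms(1) 1(1), of c] 1(2) by simp
qed (rule lac_nth_eq_0)

lemma fls_abs_lac_le:
  fixes c :: "nat \<Rightarrow> 'a::{field,finite}"
  assumes "r \<ge> 2" "\<And>k. 1 \<le> k \<Longrightarrow> k < K \<Longrightarrow> c k = 0"
  shows "fls_abs (lac r c) \<le> real CARD('a) powr (- real (r ^ K))"
proof -
  have "fls_abs (lac r c) \<le> real CARD('a) powr (- real_of_int (int (r ^ K)))"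
    using lac_nth_below[OF assms] by (subst fls_abs_le_iff) auto
  thus ?thesis by simp
qed

lemma fls_abs_lac_eq:
  fixes c :: "nat \<Rightarrow> 'a::{field,finite}"
  assumes "r \<ge> 2" "\<And>k. 1 \<le> k \<Longrightarrow> k < K \<Longrightarrow> c k = 0" "K \<ge> 1" "c K \<noteq> 0"
  shows "fls_abs (lac r c) = real CARD('a) powr (- real (r ^ K))"
proof -
  have "fls_abs (lac r c) = real CARD('a) powr (- real_of_int (int (r ^ K)))"
    using lac_nth_power[OF assms(1,3), of c] assms(4) lac_nth_below[OF assms(1,2)]
    by (intro fls_abs_eqI) auto
  thus ?thesis by simp
qed

text \<open>The exponents \<open>r^K\<close> are unbounded, so the difference has no first nonzero
  coefficient.\<close>

lemma eq_if_all_fls_abs_le: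
  fixes x y :: "'a::{field,finite} fls"
  assumes "r \<ge> 2" "\<And>K. fls_abs (x - y) \<le> real CARD('a) powr (- real (r ^ K))"
  shows "x = y"
proof (rule ccontr)
  assume "x \<noteq> y"
  define d where "d = nat (fls_subdegree (x - y)) + 1"
  have "fls_abs (x - y) \<le> real CARD('a) powr (- real_of_int (int (r ^ d)))"
    using assms(2)[of d] by simp
  moreover have "fls_subdegree (x - y) < int (r ^ d)"
    using less_exp[of d] power_mono[of 2 r d] assms unfolding d_def by linarith
  ultimately have "(x - y) $$ fls_subdegree (x - y) = 0"
    unfolding fls_abs_le_iff by blast
  thus False using \<open>x \<noteq> y\<close> nth_fls_subdegree_nonzero[of "x - y"] by simp
qed

text \<open>Raising to the power \<open>r^M\<close> is additive, fixes every \<open>c k\<close> and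
  sends \<open>T^(-r^k)\<close> to \<open>T^(-r^(k + M))\<close>, so it shifts indices by
  \<open>M\<close>. Splitting at an arbitrary \<open>K\<close> reduces this to finite sums.\<close>

lemma lac_frobenius:
  fixes c :: "nat \<Rightarrow> 'a::{field,finite}"
  assumes p: "Factorial_Ring.prime p" "CHAR('a) = p" and r: "r = p ^ a" "a \<ge> 1"
    and c: "\<And>k. c k ^ (r ^ M) = c k"
  shows "lac r c ^ (r ^ M) = lac r (\<lambda>k. if k \<le> M then 0 else c (k - M))"
    (is "_ = lac r ?sh")
proof -
  have r2: "r \<ge> 2"
    using r prime_ge_2_nat[OF p(1)] self_le_power[of p a] by simp
  have fro: "(x + y) ^ (r ^ M) = x ^ (r ^ M) + y ^ (r ^ M)" for x y :: "'a fls"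
    using p r by (intro freshmans_dream'[where n="a * M"]) (auto simp: power_mult)
  have fros: "sum f A ^ (r ^ M) = (\<Sum>i\<in>A. f i ^ (r ^ M))" for f :: "nat \<Rightarrow> 'a fls" and A
    using p r by (intro freshmans_dream_sum'[where n="a * M"]) (auto simp: power_mult)
  have fc: "fls_const (u ^ n) = fls_const u ^ n" for u :: 'a and n
    by (induction n) (auto simp flip: fls_const_mult_const)
  show ?thesis
  proof (rule eq_if_all_fls_abs_le[OF r2])
    fix K
    define hd where "hd = (\<lambda>k. if k \<le> K then c k else 0)"
    define tl where "tl = (\<lambda>k. if k \<le> K then 0 else c k)"
    have c_eq: "lac r c = lac r hd + lac r tl"
      by (subst lac_add[OF r2, symmetric], rule lac_cong[OF r2]) (auto simp: hd_def tl_def)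
    have "lac r hd ^ (r ^ M) = (\<Sum>k=1..K. (fls_const (c k) * fls_X ^ (r ^ k)) ^ (r ^ M))"
      by (subst lac_finite[OF r2, of K]) (auto simp: hd_def fros)
    also have "\<dots> = (\<Sum>k=1..K. fls_const (c k) * fls_X ^ (r ^ (k + M)))"
      by (simp add: power_mult_distrib c power_add flip: power_mult fc)
    also have "\<dots> = (\<Sum>k=1+M..K+M. fls_const (?sh k) * fls_X ^ (r ^ k))"
      unfolding sum.shift_bounds_cl_nat_ivl by (auto intro!: sum.cong)
    also have "\<dots> = (\<Sum>k=1..K+M. fls_const (if k \<le> K + M then ?sh k else 0) * fls_X ^ (r ^ k))"
      by (intro sum.mono_neutral_cong_left) auto
    also have "\<dots> = lac r (\<lambda>k. if k \<le> K + M then ?sh k else 0)"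
      by (subst lac_finite[OF r2, of "K + M"]) auto
    finally have "lac r hd ^ (r ^ M) - lac r ?sh =
        lac r (\<lambda>k. (if k \<le> K + M then ?sh k else 0) - ?sh k)"
      by (simp add: lac_diff[OF r2])
    hence "fls_abs (lac r hd ^ (r ^ M) - lac r ?sh) \<le> real CARD('a) powr (- real (r ^ K))"
      using fls_abs_lac_le[OF r2, of K "\<lambda>k. (if k \<le> K + M then ?sh k else 0) - ?sh k"]
      by (simp del: of_nat_power)
    moreover have tl: "fls_abs (lac r tl) \<le> real CARD('a) powr (- real (r ^ K))"
      by (rule fls_abs_lac_le[OF r2]) (auto simp: tl_def)
    \<comment> \<open>As the tail has absolute value at most 1, raising it to a power cannot enlarge
      it.\<close>
    have "real CARD('a) powr (- real (r ^ K)) \<le> real CARD('a) powr 0"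
      using card_finite_field_gt_1[where 'a='a] by (intro powr_mono) auto
    with tl have "fls_abs (lac r tl) \<le> 1"
      using card_finite_field_gt_1[where 'a='a] by simp
    hence "fls_abs (lac r tl) ^ (r ^ M) \<le> fls_abs (lac r tl) ^ 1"
      using r2 by (intro power_decreasing) auto
    hence "fls_abs (lac r tl ^ (r ^ M)) \<le> real CARD('a) powr (- real (r ^ K))"
      using tl by (simp add: fls_abs_power)
    ultimately have "fls_abs ((lac r hd ^ (r ^ M) - lac r ?sh) + lac r tl ^ (r ^ M))
        \<le> real CARD('a) powr (- real (r ^ K))"
      by (rule fls_abs_add_le)
    thus "fls_abs (lac r c ^ (r ^ M) - lac r ?sh) \<le> real CARD('a) powr (- real (r ^ K))"
      by (simp add: c_eq fro algebra_simps)
  qed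
qed

section \<open>Polynomials over \<open>\<F>\<^sub>q[T]\<close>\<close>

text \<open>Ring homomorphisms applied to coefficients. The same facts serve four maps: constants
  into Laurent series, constants into polynomials, \<open>of_Tpoly\<close>, and
  \<open>of_Tpoly\<close> followed by \<open>to_ac\<close>.\<close>

locale coeff_hom =
  fixes h :: "'b::comm_ring_1 \<Rightarrow> 'c::comm_ring_1"
  assumes zero [simp]: "h 0 = 0" and one [simp]: "h 1 = 1"
    and add: "h (x + y) = h x + h y" and mult: "h (x * y) = h x * h y"
begin

lemma minus: "h (- x) = - h x"
  using add[of x "- x"] by (simp add: eq_neg_iff_add_eq_0 add.commute)

lemma diff: "h (x - y) = h x - h y"
  using add[of x "- y"] by (simp add: minus)

lemma sum: "h (sum f A) = (\<Sum>i\<in>A. h (f i))"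
  by (induction A rule: infinite_finite_induct) (simp_all add: add)

lemma power: "h (x ^ n) = h x ^ n"
  by (induction n) (simp_all add: mult)

lemma map_poly_add: "map_poly h (P + Q) = map_poly h P + map_poly h Q"
  by (rule poly_eqI) (simp add: coeff_map_poly add)

lemma map_poly_diff: "map_poly h (P - Q) = map_poly h P - map_poly h Q"
  by (rule poly_eqI) (simp add: coeff_map_poly diff)

lemma map_poly_mult: "map_poly h (P * Q) = map_poly h P * map_poly h Q"
  by (rule poly_eqI) (simp add: coeff_map_poly coeff_mult sum mult)

lemma map_poly_power: "map_poly h (P ^ n) = map_poly h P ^ n"
  by (induction n) (simp_all add: map_poly_mult)

lemma eval_eq_sum:
  assumes "Polynomial.degree P \<le> N"
  shows "poly (map_poly h P) x = (\<Sum>i\<le>N. h (Polynomial.coeff P i) * x ^ i)"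
proof -
  have "Polynomial.degree (map_poly h P) \<le> N"
    using map_poly_degree_leq[of h P] assms by simp
  hence "poly (map_poly h P) x = (\<Sum>i\<le>N. Polynomial.coeff (map_poly h P) i * x ^ i)"
    unfolding poly_altdef by (intro sum.mono_neutral_left) (auto simp: coeff_eq_0)
  thus ?thesis by (simp add: coeff_map_poly)
qed

lemma eval_pcompose:
  "poly (map_poly h (pcompose P Q)) x = poly (map_poly h P) (poly (map_poly h Q) x)"
  by (induction P) (simp_all add: pcompose_pCons map_poly_add map_poly_mult map_poly_pCons)

end

interpretation fls_const: coeff_hom "fls_const :: 'a::comm_ring_1 \<Rightarrow> 'a fls"
  by standard (simp_all add: fls_plus_const)

interpretation const_poly: coeff_hom "\<lambda>a :: 'a::comm_ring_1. [:a:]"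
  by standard simp_all

interpretation of_Tpoly: coeff_hom "of_Tpoly :: 'a::{field,finite} poly \<Rightarrow> 'a fls"
  by standard (simp_all add: of_Tpoly_def fls_const.map_poly_add fls_const.map_poly_mult)

interpretation ac_of_Tpoly: coeff_hom "\<lambda>c :: 'a::{field,finite} poly. to_ac (of_Tpoly c)"
  by standard (simp_all add: of_Tpoly.add of_Tpoly.mult)

lemma of_Tpoly_nth:
  "of_Tpoly c $$ n = (if n \<le> 0 then Polynomial.coeff c (nat (- n)) else 0)"
proof -
  \<comment> \<open>Large enough for both the degree of \<open>c\<close> and the index
    \<open>nat (- n)\<close>, so the sum always contains the wanted term.\<close>
  define N where "N = Polynomial.degree c + nat (- n)"
  have "of_Tpoly c $$ n = (\<Sum>i\<le>N. if i = nat (- n) \<and> n \<le> 0 then Polynomial.coeff c i else 0)"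
    unfolding of_Tpoly_def
    by (subst fls_const.eval_eq_sum[of _ N])
       (auto simp: N_def fls_nth_sum intro!: sum.cong)
  also have "\<dots> = (if n \<le> 0 then Polynomial.coeff c (nat (- n)) else 0)"
    by (auto simp: N_def)
  finally show ?thesis .
qed

lemma of_Tpoly_eq_0_iff [simp]: "of_Tpoly c = 0 \<longleftrightarrow> c = 0"
proof
  assume c: "of_Tpoly c = 0"
  have "Polynomial.coeff c i = of_Tpoly c $$ (- int i)" for i
    by (simp add: of_Tpoly_nth)
  thus "c = 0" using c by (intro poly_eqI) simp
qed simp

lemma of_Tpoly_const: "of_Tpoly [:u:] = fls_const u"
  by (simp add: of_Tpoly_def map_poly_pCons)

lemma of_Tpoly_monom: "of_Tpoly (Polynomial.monom u n) = fls_const u * fls_X_inv ^ n"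
  by (simp add: of_Tpoly_def map_poly_monom poly_monom)

lemma fls_abs_of_Tpoly:
  fixes c :: "'a::{field,finite} poly"
  assumes "c \<noteq> 0"
  shows "fls_abs (of_Tpoly c) = real CARD('a) powr real (Polynomial.degree c)"
proof -
  have "fls_abs (of_Tpoly c) = real CARD('a) powr (- real_of_int (- int (Polynomial.degree c)))"
    using assms by (intro fls_abs_eqI) (auto simp: of_Tpoly_nth coeff_eq_0)
  thus ?thesis by simp
qed

lemma fls_abs_of_Tpoly_ge_1:
  fixes c :: "'a::{field,finite} poly"
  assumes "c \<noteq> 0"
  shows "fls_abs (of_Tpoly c) \<ge> 1"
  using assms card_finite_field_gt_1[where 'a='a] by (simp add: fls_abs_of_Tpoly ge_one_powr_ge_zero)

lemma fls_abs_of_Tpoly_le: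
  fixes c :: "'a::{field,finite} poly"
  assumes "\<And>j. j > t \<Longrightarrow> Polynomial.coeff c j = 0"
  shows "fls_abs (of_Tpoly c) \<le> real CARD('a) powr real t"
proof (cases "c = 0")
  case False
  have "Polynomial.degree c \<le> t" using assms by (intro degree_le) auto
  thus ?thesis using False card_finite_field_gt_1[where 'a='a] by (simp add: fls_abs_of_Tpoly)
qed simp

section \<open>The degree in T and the height\<close>

definition tdeg :: "'a::zero poly poly \<Rightarrow> nat" where
  "tdeg P = (MAX i\<in>{..Polynomial.degree P}. Polynomial.degree (Polynomial.coeff P i))"

lemma degree_coeff_le_tdeg: "Polynomial.degree (Polynomial.coeff P i) \<le> tdeg P"
proof (cases "i \<le> Polynomial.degree P")
  case True
  thus ?thesis unfolding tdeg_def by (intro Max_ge) auto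
qed (simp add: coeff_eq_0)

lemma tdeg_le:
  assumes "\<And>i. Polynomial.degree (Polynomial.coeff P i) \<le> t"
  shows "tdeg P \<le> t"
  using assms unfolding tdeg_def by (subst Max_le_iff) auto

text \<open>When the maximum is 0, zero coefficients attain it too, so the leading coefficient is
  chosen.\<close>

lemma tdeg_attained:
  assumes "P \<noteq> 0"
  obtains i where "Polynomial.coeff P i \<noteq> 0" "Polynomial.degree (Polynomial.coeff P i) = tdeg P"
proof (cases "tdeg P = 0")
  case True
  thus ?thesis
    using that[of "Polynomial.degree P"] assms degree_coeff_le_tdeg[of P "Polynomial.degree P"] by auto
next
  case False
  have "tdeg P \<in> (\<lambda>i. Polynomial.degree (Polynomial.coeff P i)) ` {..Polynomial.degree P}"
    unfolding tdeg_def by (rule Max_in) auto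
  then obtain i where "Polynomial.degree (Polynomial.coeff P i) = tdeg P" by auto
  moreover from this have "Polynomial.coeff P i \<noteq> 0" using False by auto
  ultimately show ?thesis using that by blast
qed

text \<open>For nonzero \<open>P\<close> the number \<open>tdeg P\<close> is the logarithm of the
  height to base \<open>q\<close>, so height estimates become counts of degrees.\<close>

lemma height_poly_eq_tdeg:
  fixes P :: "'a::{field,finite} poly poly"
  assumes "P \<noteq> 0"
  shows "height_poly P = real CARD('a) powr real (tdeg P)"
  unfolding height_poly_def
proof (rule Max_eqI)
  show "finite ((\<lambda>i. fls_abs (of_Tpoly (Polynomial.coeff P i))) ` {..Polynomial.degree P})" by simp
next
  fix y assume "y \<in> (\<lambda>i. fls_abs (of_Tpoly (Polynomial.coeff P i))) ` {..Polynomial.degree P}"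
  then obtain i where y: "y = fls_abs (of_Tpoly (Polynomial.coeff P i))" by blast
  show "y \<le> real CARD('a) powr real (tdeg P)"
    unfolding y using degree_coeff_le_tdeg[of P i]
    by (intro fls_abs_of_Tpoly_le) (auto simp: coeff_eq_0)
next
  obtain i where i: "Polynomial.coeff P i \<noteq> 0" "Polynomial.degree (Polynomial.coeff P i) = tdeg P"
    by (rule tdeg_attained[OF assms])
  hence "i \<le> Polynomial.degree P" by (intro le_degree)
  thus "real CARD('a) powr real (tdeg P) \<in>
      (\<lambda>i. fls_abs (of_Tpoly (Polynomial.coeff P i))) ` {..Polynomial.degree P}"
    using i fls_abs_of_Tpoly[OF i(1)] by (intro image_eqI[of _ _ i]) auto
qed

text \<open>Coefficients of the product at the last indices where the \<open>T\<close>-degrees are attained do not cancel.\<close>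

lemma tdeg_mult_ge:
  fixes P Q :: "'a::idom poly poly"
  assumes "P \<noteq> 0" "Q \<noteq> 0"
  shows "tdeg P + tdeg Q \<le> tdeg (P * Q)"
proof -
  let ?top = "\<lambda>P i. Polynomial.coeff (Polynomial.coeff P i) (tdeg P)"
  have last: "\<exists>i. ?top P i \<noteq> 0 \<and> (\<forall>k>i. ?top P k = 0)" if P: "P \<noteq> 0" for P :: "'a poly poly"
  proof -
    obtain i where i: "Polynomial.coeff P i \<noteq> 0"
        "Polynomial.degree (Polynomial.coeff P i) = tdeg P"
      by (rule tdeg_attained[OF P])
    have top: "?top P i \<noteq> 0"
      unfolding i(2)[symmetric] using i(1) by (simp only: leading_coeff_0_iff not_False_eq_True)
    define m where "m = Max {k. ?top P k \<noteq> 0}"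
    have "{k. ?top P k \<noteq> 0} \<subseteq> {..Polynomial.degree P}"
    proof
      fix k assume "k \<in> {k. ?top P k \<noteq> 0}"
      hence "Polynomial.coeff P k \<noteq> 0"
        by (cases "Polynomial.coeff P k = 0") simp_all
      thus "k \<in> {..Polynomial.degree P}" by (simp add: le_degree)
    qed
    hence fin: "finite {k. ?top P k \<noteq> 0}" by (rule finite_subset) simp
    hence "?top P m \<noteq> 0" using Max_in[OF fin] top unfolding m_def by blast
    moreover have "?top P k = 0" if "k > m" for k
    proof (rule ccontr)
      assume "?top P k \<noteq> 0"
      hence "k \<in> {k. ?top P k \<noteq> 0}" by simp
      hence "k \<le> m" unfolding m_def by (rule Max_ge[OF fin])
      thus False using that by simp
    qed
    ultimately show ?thesis by blast
  qed
  have top_mult: "Polynomial.coeff (p * q) (a + b) = Polynomial.coeff p a * Polynomial.coeff q b"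
    if "Polynomial.degree p \<le> a" "Polynomial.degree q \<le> b" for p q :: "'a poly" and a b
    using that
  proof (cases "Polynomial.degree p = a \<and> Polynomial.degree q = b")
    case True
    thus ?thesis using coeff_mult_degree_sum[of p q] by auto
  next
    case False
    hence "Polynomial.degree (p * q) < a + b" "Polynomial.degree p < a \<or> Polynomial.degree q < b"
      using that degree_mult_le[of p q] by linarith+
    thus ?thesis by (auto simp: coeff_eq_0)
  qed
  obtain i j where i: "?top P i \<noteq> 0" "\<forall>k>i. ?top P k = 0"
    and j: "?top Q j \<noteq> 0" "\<forall>k>j. ?top Q k = 0"
    using last[OF assms(1)] last[OF assms(2)] by blast
  have "Polynomial.coeff (Polynomial.coeff (P * Q) (i + j)) (tdeg P + tdeg Q) =
      (\<Sum>k\<le>i + j. ?top P k * ?top Q (i + j - k))"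
    unfolding coeff_mult[of P] coeff_sum by (intro sum.cong refl top_mult degree_coeff_le_tdeg)
  also have "\<dots> = (\<Sum>k\<le>i + j. if k = i then ?top P i * ?top Q j else 0)"
  proof (rule sum.cong)
    fix k assume "k \<in> {..i + j}"
    consider "k = i" | "k > i" | "i + j - k > j" using nat_neq_iff[of k i] \<open>k \<in> _\<close> by fastforce
    thus "?top P k * ?top Q (i + j - k) = (if k = i then ?top P i * ?top Q j else 0)"
      using i(2) j(2) by cases auto
  qed simp
  also have "\<dots> \<noteq> 0" using i(1) j(1) by simp
  finally have "tdeg P + tdeg Q \<le> Polynomial.degree (Polynomial.coeff (P * Q) (i + j))"
    by (rule le_degree)
  thus ?thesis using degree_coeff_le_tdeg order_trans by blast
qed

section \<open>A pigeonhole construction\<close>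

text \<open>Listing the first \<open>d\<close> coefficients is a bijection. A general
  \<open>S\<close> allows two uses: for polynomials in T, and then for polynomials in X with such
  coefficients.\<close>

lemma card_bounded_polys:
  fixes S :: "'b::zero set"
  assumes "finite S" "0 \<in> S"
  shows "finite {p. (\<forall>i. Polynomial.coeff p i \<in> S) \<and> (\<forall>i\<ge>d. Polynomial.coeff p i = 0)}" (is "finite ?A")
    and "card {p. (\<forall>i. Polynomial.coeff p i \<in> S) \<and> (\<forall>i\<ge>d. Polynomial.coeff p i = 0)} = card S ^ d"
proof -
  have bij: "bij_betw (\<lambda>p. \<lambda>i\<in>{..<d}. Polynomial.coeff p i) ?A (PiE {..<d} (\<lambda>_. S))"
  proof (rule bij_betwI')
    fix p q assume pq: "p \<in> ?A" "q \<in> ?A"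
    show "(\<lambda>i\<in>{..<d}. Polynomial.coeff p i) = (\<lambda>i\<in>{..<d}. Polynomial.coeff q i) \<longleftrightarrow> p = q"
    proof
      assume eq: "(\<lambda>i\<in>{..<d}. Polynomial.coeff p i) = (\<lambda>i\<in>{..<d}. Polynomial.coeff q i)"
      show "p = q"
      proof (rule poly_eqI)
        fix i show "Polynomial.coeff p i = Polynomial.coeff q i"
          using fun_cong[OF eq, of i] pq by (cases "i < d") auto
      qed
    qed simp
  next
    fix p assume "p \<in> ?A"
    thus "(\<lambda>i\<in>{..<d}. Polynomial.coeff p i) \<in> PiE {..<d} (\<lambda>_. S)" by auto
  next
    fix f assume f: "f \<in> PiE {..<d} (\<lambda>_. S)"
    define p where "p = Abs_poly (\<lambda>i. if i < d then f i else 0)"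
    have coeff: "Polynomial.coeff p i = (if i < d then f i else 0)" for i
      unfolding p_def by (subst coeff_Abs_poly[of d]) auto
    have "(\<lambda>i\<in>{..<d}. Polynomial.coeff p i) i = f i" for i
      using PiE_arb[OF f, of i] by (cases "i < d") (auto simp: coeff)
    moreover have "p \<in> ?A" using f assms by (auto simp: coeff)
    ultimately show "\<exists>p\<in>?A. f = (\<lambda>i\<in>{..<d}. Polynomial.coeff p i)"
      by (intro bexI[of _ p]) auto
  qed
  show "finite ?A"
    using bij_betw_finite[OF bij] assms(1) by (simp add: finite_PiE)
  show "card ?A = card S ^ d"
    using bij_betw_same_card[OF bij] by (simp add: card_PiE)
qed

text \<open>Both bounds are strict: \<open>d\<close> coefficients in X, each with \<open>t\<close>
  coefficients in T. Over the finite field this is an additive group of exactly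
  \<open>q^(t * d)\<close> elements, zero included.\<close>

definition tbox :: "nat \<Rightarrow> nat \<Rightarrow> 'a::zero poly poly set" where
  "tbox d t = {P. (\<forall>i\<ge>d. Polynomial.coeff P i = 0) \<and>
                  (\<forall>i. \<forall>j\<ge>t. Polynomial.coeff (Polynomial.coeff P i) j = 0)}"

lemma card_tbox:
  shows "finite (tbox d t :: 'a::{field,finite} poly poly set)"
    and "card (tbox d t :: 'a::{field,finite} poly poly set) = CARD('a) ^ (t * d)"
proof -
  let ?S = "{p :: 'a poly. (\<forall>i. Polynomial.coeff p i \<in> UNIV) \<and> (\<forall>i\<ge>t. Polynomial.coeff p i = 0)}"
  have S: "finite ?S" "card ?S = CARD('a) ^ t"
    by (rule card_bounded_polys; simp)+
  have eq: "tbox d t = {P. (\<forall>i. Polynomial.coeff P i \<in> ?S) \<and> (\<forall>i\<ge>d. Polynomial.coeff P i = 0)}"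
    by (auto simp: tbox_def)
  show "finite (tbox d t :: 'a poly poly set)"
    unfolding eq by (rule card_bounded_polys) (use S in auto)
  have "card (tbox d t :: 'a poly poly set) = card ?S ^ d"
    unfolding eq by (rule card_bounded_polys) (use S in auto)
  thus "card (tbox d t :: 'a poly poly set) = CARD('a) ^ (t * d)"
    by (simp only: S(2) power_mult)
qed

lemma tbox_diff:
  fixes P Q :: "'a::ab_group_add poly poly"
  shows "P \<in> tbox d t \<Longrightarrow> Q \<in> tbox d t \<Longrightarrow> P - Q \<in> tbox d t"
  by (simp add: tbox_def)

lemma tbox_mult:
  fixes P Q :: "'a::comm_ring_1 poly poly"
  assumes "P \<in> tbox (Suc n) (Suc h)" "Q \<in> tbox d t" "d \<ge> 1" "t \<ge> 1"
  shows "P * Q \<in> tbox (n + d) (h + t)"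
proof -
  have *: "Polynomial.coeff p k * Polynomial.coeff q (i - k) = 0"
    if "\<forall>i\<ge>Suc a. Polynomial.coeff p i = 0" "\<forall>i\<ge>b. Polynomial.coeff q i = 0" "i \<ge> a + b"
    for p q :: "'b::comm_ring_1 poly" and a b i k
    using that by (cases "k \<ge> Suc a") auto
  show ?thesis
    unfolding tbox_def
  proof (safe)
    fix i assume "n + d \<le> i"
    thus "Polynomial.coeff (P * Q) i = 0"
      using assms * [of n P d Q i] by (auto simp: tbox_def coeff_mult)
  next
    fix i j assume j: "h + t \<le> j"
    have "Polynomial.coeff (Polynomial.coeff P k * Polynomial.coeff Q (i - k)) j = 0" for k
      unfolding coeff_mult
      using assms j by (intro sum.neutral ballI *[of h _ t]) (auto simp: tbox_def)
    thus "Polynomial.coeff (Polynomial.coeff (P * Q) i) j = 0"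
      by (simp add: coeff_mult[of P] coeff_sum)
  qed
qed

text \<open>The coefficients of \<open>z\<close> are constants, so substitution only forms linear
  combinations of the coefficients of \<open>F\<close> and keeps their bound on the degree in
  T.\<close>

lemma tbox_pcompose:
  fixes F :: "'a::idom poly poly" and z :: "'a poly"
  assumes "F \<in> tbox (Suc n) t" "Polynomial.degree z \<le> R"
  shows "pcompose F (map_poly (\<lambda>a. [:a:]) z) \<in> tbox (Suc (n * R)) t"
proof -
  have deg: "Polynomial.degree F \<le> n" using assms by (intro degree_le) (auto simp: tbox_def)
  have "Polynomial.coeff (pcompose F (map_poly (\<lambda>a. [:a:]) z)) i = 0" if "i \<ge> Suc (n * R)" for i
    using degree_pcompose_le[of F "map_poly (\<lambda>a. [:a:]) z"]
      mult_le_mono[OF deg order_trans[OF map_poly_degree_leq[of "\<lambda>a. [:a:]" z] assms(2)]] that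
    by (intro coeff_eq_0) simp
  moreover have "Polynomial.coeff (pcompose F (map_poly (\<lambda>a. [:a:]) z)) i =
      (\<Sum>k\<le>n. Polynomial.smult (Polynomial.coeff (z ^ k) i) (Polynomial.coeff F k))" for i
    unfolding pcompose_altdef const_poly.eval_eq_sum[OF deg] coeff_sum
    by (simp add: coeff_map_poly mult.commute flip: const_poly.map_poly_power)
  ultimately show ?thesis
    using assms(1) unfolding tbox_def mem_Collect_eq by (simp add: coeff_sum)
qed

text \<open>
  Over the algebraic closure one could take \<open>\<Prod>\<^sub>u P(X + u)\<close> with \<open>u\<close> ranging over the roots of
  \<open>X\<^sup>R - X\<close>; counting coefficients avoids that extension of the ground field.
\<close>

lemma composition_multiple_exists:
  fixes P :: "'a::{field,finite} poly poly"
  assumes "P \<noteq> 0" "Polynomial.degree P \<le> n" "Polynomial.degree z \<le> R" "R \<ge> 1"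
  defines "t \<equiv> Suc ((n * R - n + 1) * tdeg P)"
  obtains F G where "F \<noteq> 0" "F \<in> tbox (Suc n) t" "G \<in> tbox (n * R - n + 1) t"
    "pcompose F (map_poly (\<lambda>a. [:a:]) z) = P * G"
proof -
  define h where "h = tdeg P"
  define g where "g = n * R - n + 1"
  have t: "t = Suc (g * h)" by (simp add: t_def g_def h_def)
  have nR: "n * R \<ge> n" using assms(4) by simp
  have th: "t > h" using t g_def by simp
  let ?Z = "map_poly (\<lambda>a. [:a:]) z"
  \<comment> \<open>Candidate pairs \<open>(F, G)\<close>: \<open>P * G\<close> has degree at most
    \<open>n * R\<close> in X because \<open>n + g = n * R + 1\<close>, and degree below
    \<open>t\<close> in T because \<open>G\<close> stays below \<open>t - h\<close>.\<close>
  let ?D = "tbox (Suc n) t \<times> tbox g (t - h) :: ('a poly poly \<times> 'a poly poly) set"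
  define \<phi> where "\<phi> = (\<lambda>(F, G). pcompose F ?Z - P * G)"
  have P: "P \<in> tbox (Suc n) (Suc h)"
    using assms(2) order_le_less_trans[OF degree_coeff_le_tdeg[of P]]
    by (auto simp: tbox_def coeff_eq_0 h_def Suc_le_eq)
  have "\<phi> ` ?D \<subseteq> tbox (Suc (n * R)) t"
  proof safe
    fix F G :: "'a poly poly" assume FG: "F \<in> tbox (Suc n) t" "G \<in> tbox g (t - h)"
    have "P * G \<in> tbox (n + g) (h + (t - h))"
      using P FG(2) th by (intro tbox_mult) (auto simp: g_def)
    hence "P * G \<in> tbox (Suc (n * R)) t" using th nR by (simp add: g_def)
    thus "\<phi> (F, G) \<in> tbox (Suc (n * R)) t"
      using tbox_pcompose[OF FG(1) assms(3)] by (simp add: \<phi>_def tbox_diff)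
  qed
  hence "card (\<phi> ` ?D) \<le> CARD('a) ^ (t * Suc (n * R))"
    using card_mono card_tbox by metis
  \<comment> \<open>The choice \<open>t = g * h + 1\<close> makes the exponents differ by
    \<open>t - h * g = 1\<close>, so there are more pairs than values.\<close>
  also have "\<dots> < CARD('a) ^ (t * Suc n + (t - h) * g)"
  proof (rule power_strict_increasing)
    obtain s where s: "t = h + s" "s > 0" using th less_imp_add_positive by blast
    have g: "n + g = Suc (n * R)" using nR by (simp add: g_def)
    have "t * Suc n + (t - h) * g + h * g = t * Suc n + t * g"
      by (simp add: s(1) algebra_simps)
    also have "\<dots> = t * (n + g) + t" by (simp add: algebra_simps)
    also have "\<dots> = t * Suc (n * R) + t" by (simp only: g)
    finally show "t * Suc (n * R) < t * Suc n + (t - h) * g" using t by (simp add: mult.commute)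
    show "1 < CARD('a)" using card_finite_field_gt_1[where 'a='a] by simp
  qed
  also have "\<dots> = card ?D"
    by (simp add: card_cartesian_product card_tbox power_add)
  finally have "\<not> inj_on \<phi> ?D" using card_image by force
  then obtain F1 G1 F2 G2 where 1: "(F1, G1) \<in> ?D" "(F2, G2) \<in> ?D" "\<phi> (F1, G1) = \<phi> (F2, G2)"
      "(F1, G1) \<noteq> (F2, G2)"
    unfolding inj_on_def by (metis surj_pair)
  have eq: "pcompose (F1 - F2) ?Z = P * (G1 - G2)"
    using 1(3) by (simp add: \<phi>_def pcompose_diff algebra_simps)
  \<comment> \<open>Equal \<open>F\<close> would force equal \<open>G\<close>, because
    \<open>P\<close> is nonzero.\<close>
  have "F1 - F2 \<noteq> 0"
  proof
    assume "F1 - F2 = 0"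
    hence "G1 - G2 = 0" using eq assms(1) by simp
    thus False using 1(4) \<open>F1 - F2 = 0\<close> by simp
  qed
  moreover have "F1 - F2 \<in> tbox (Suc n) t" using 1 by (intro tbox_diff) auto
  moreover have "G1 - G2 \<in> tbox g (t - h)" using 1 by (intro tbox_diff) auto
  hence "G1 - G2 \<in> tbox (n * R - n + 1) t" by (auto simp: tbox_def g_def)
  ultimately show ?thesis using eq that by blast
qed

section \<open>Minimal polynomials\<close>

lemma eval_ac_mult: "eval_ac (P * Q) \<alpha> = eval_ac P \<alpha> * eval_ac Q \<alpha>"
  by (simp add: eval_ac_def ac_of_Tpoly.map_poly_mult)

lemma eval_ac_smult: "eval_ac (Polynomial.smult c P) \<alpha> = to_ac (of_Tpoly c) * eval_ac P \<alpha>"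
  using eval_ac_mult[of "[:c:]" P \<alpha>] by (simp add: eval_ac_def map_poly_pCons)

lemma eval_ac_diff: "eval_ac (P - Q) \<alpha> = eval_ac P \<alpha> - eval_ac Q \<alpha>"
  by (simp add: eval_ac_def ac_of_Tpoly.map_poly_diff)

lemma eval_ac_const: "eval_ac [:c:] \<alpha> = to_ac (of_Tpoly c)"
  by (simp add: eval_ac_def map_poly_pCons)

lemma eval_ac_to_ac: "eval_ac P (to_ac x) = to_ac (eval_fls P x)"
  unfolding eval_ac_def eval_fls_def
    ac_of_Tpoly.eval_eq_sum[OF order.refl] of_Tpoly.eval_eq_sum[OF order.refl]
  by (simp add: to_ac_sum)

lemma finite_roots_eval_ac:
  assumes "P \<noteq> 0"
  shows "finite {\<alpha>. eval_ac P \<alpha> = 0}"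
  unfolding eval_ac_def using assms
  by (intro poly_roots_finite) (subst map_poly_eq_0_iff, auto)

text \<open>Multiplying \<open>f\<close> by the product of all denominators yields coefficients in
  the polynomial ring.\<close>

lemma algebraic_numbers_T_root:
  fixes \<alpha> :: "'a::{field,finite} fls alg_closure"
  assumes "\<alpha> \<in> algebraic_numbers_T"
  obtains P where "P \<noteq> 0" "eval_ac P \<alpha> = 0"
proof -
  obtain f where f: "f \<noteq> 0" "\<And>i. Polynomial.coeff f i \<in> Tfractions" "poly f \<alpha> = 0"
    using assms unfolding algebraic_numbers_T_def by blast
  have "\<exists>a b. Polynomial.coeff f i = to_ac (of_Tpoly a / of_Tpoly b) \<and> b \<noteq> 0" for i
    using f(2)[of i] unfolding Tfractions_def by blast
  then obtain a b where ab: "\<And>i. Polynomial.coeff f i = to_ac (of_Tpoly (a i) / of_Tpoly (b i))"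
      "\<And>i. b i \<noteq> 0"
    by metis
  define N where "N = Polynomial.degree f"
  define D where "D = (\<Prod>i\<le>N. b i)"
  define P where "P = (\<Sum>i\<le>N. Polynomial.monom (a i * (\<Prod>j\<in>{..N} - {i}. b j)) i)"
  have coeff: "Polynomial.coeff P i = (if i \<le> N then a i * (\<Prod>j\<in>{..N} - {i}. b j) else 0)" for i
    by (simp add: P_def coeff_sum)
  have h: "to_ac (of_Tpoly (Polynomial.coeff P i)) = to_ac (of_Tpoly D) * Polynomial.coeff f i"
    if "i \<le> N" for i
  proof -
    have "D = b i * (\<Prod>j\<in>{..N} - {i}. b j)"
      unfolding D_def using that by (subst prod.remove[of _ i]) auto
    hence "of_Tpoly (Polynomial.coeff P i) = of_Tpoly D * (of_Tpoly (a i) / of_Tpoly (b i))"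
      using that ab(2)[of i] by (simp add: coeff of_Tpoly.mult)
    thus ?thesis by (simp add: ab(1))
  qed
  have "Polynomial.degree P \<le> N" by (intro degree_le) (auto simp: coeff)
  hence "eval_ac P \<alpha> = (\<Sum>i\<le>N. to_ac (of_Tpoly (Polynomial.coeff P i)) * \<alpha> ^ i)"
    unfolding eval_ac_def by (rule ac_of_Tpoly.eval_eq_sum)
  also have "\<dots> = to_ac (of_Tpoly D) * poly f \<alpha>"
    by (simp add: h poly_altdef N_def sum_distrib_left mult.assoc)
  finally have "eval_ac P \<alpha> = 0" using f(3) by simp
  moreover have "P \<noteq> 0"
  proof
    assume "P = 0"
    hence "to_ac (of_Tpoly D) * Polynomial.coeff f N = 0" using h[of N] by simp
    moreover have "D \<noteq> 0" unfolding D_def using ab(2) by simp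
    ultimately show False using f(1) by (simp add: N_def)
  qed
  ultimately show ?thesis using that by blast
qed

lemma algebraic_numbers_T_I:
  assumes "P \<noteq> 0" "eval_ac P \<alpha> = 0"
  shows "\<alpha> \<in> algebraic_numbers_T"
proof -
  let ?f = "map_poly (\<lambda>c. to_ac (of_Tpoly c)) P"
  have "?f \<noteq> 0" using assms(1) by (subst map_poly_eq_0_iff) auto
  moreover have "Polynomial.coeff ?f i \<in> Tfractions" for i
  proof -
    have "Polynomial.coeff ?f i = to_ac (of_Tpoly (Polynomial.coeff P i) / of_Tpoly 1)"
      by (simp add: coeff_map_poly)
    thus ?thesis unfolding Tfractions_def by (metis (mono_tags, lifting) mem_Collect_eq one_neq_zero)
  qed
  ultimately show ?thesis using assms(2) unfolding algebraic_numbers_T_def eval_ac_def by blast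
qed

text \<open>A form of Gauss's lemma, by induction on the degree of \<open>a\<close>: an irreducible
  \<open>a\<close> is prime as a constant polynomial and cannot divide the primitive
  \<open>M\<close>, so it cancels from the cofactor; a composite \<open>a\<close> is removed one
  factor at a time.\<close>

lemma primitive_poly_dvd_smult:
  fixes M Q :: "'a::{field,finite} poly poly"
  assumes M: "primitive_poly M" and "a \<noteq> 0" "M dvd Polynomial.smult a Q"
  shows "M dvd Q"
  using assms(2,3)
proof (induction "Polynomial.degree a" arbitrary: a Q rule: less_induct)
  case less
  consider "is_unit a" | "Factorial_Ring.irreducible a"
    | b c where "a = b * c" "\<not> is_unit b" "\<not> is_unit c"
    using less.prems(1) unfolding Factorial_Ring.irreducible_def by blast
  thus ?case
  proof cases
    case 1
    then obtain a' where "1 = a * a'" by (rule dvdE)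
    hence "Q = Polynomial.smult a' (Polynomial.smult a Q)" by (simp add: mult.commute)
    thus ?thesis using less.prems(2) by (metis dvd_smult)
  next
    case 2
    obtain K where K: "Polynomial.smult a Q = M * K" using less.prems(2) by (rule dvdE)
    have "prime_elem [:a:]"
      using field_poly_irreducible_imp_prime[OF 2] by (rule lift_prime_elem_poly)
    moreover have "[:a:] dvd M * K" unfolding K[symmetric] by (rule dvdI[of _ _ Q]) simp
    ultimately have "[:a:] dvd M \<or> [:a:] dvd K" by (rule prime_elem_dvd_multD)
    moreover have "\<not> [:a:] dvd M"
    proof
      assume "[:a:] dvd M"
      hence "is_unit a" using M unfolding const_poly_dvd_iff primitive_poly_def by blast
      thus False using 2 by (simp add: Factorial_Ring.irreducible_def)
    qed
    ultimately obtain K' where "K = [:a:] * K'" by (auto elim: dvdE)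
    hence "[:a:] * Q = [:a:] * (M * K')" using K by simp
    hence "Q = M * K'" using less.prems(1) by (subst (asm) mult_cancel_left) auto
    thus ?thesis by simp
  next
    case 3
    have bc: "b \<noteq> 0" "c \<noteq> 0" using less.prems(1) 3(1) by auto
    hence "Polynomial.degree b > 0" "Polynomial.degree c > 0"
      using 3(2,3) by (auto simp: is_unit_iff_degree)
    hence deg: "Polynomial.degree b < Polynomial.degree a" "Polynomial.degree c < Polynomial.degree a"
      using bc by (auto simp: 3(1) degree_mult_eq)
    have "M dvd Polynomial.smult b (Polynomial.smult c Q)"
      using less.prems(2) by (simp add: 3(1))
    hence "M dvd Polynomial.smult c Q" by (rule less.hyps[OF deg(1) bc(1)])
    thus ?thesis by (rule less.hyps[OF deg(2) bc(2)])
  qed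
qed

text \<open>Among the annihilating polynomials of least degree in X, one whose leading coefficient
  has least degree in T is taken. The second minimality gives primitivity, since a common factor
  could be divided out.\<close>

lemma min_poly_exists:
  fixes \<alpha> :: "'a::{field,finite} fls alg_closure"
  assumes "P0 \<noteq> 0" "eval_ac P0 \<alpha> = 0"
  obtains M where "is_min_poly \<alpha> M" "\<And>Q. eval_ac Q \<alpha> = 0 \<Longrightarrow> M dvd Q"
proof -
  define S where "S = {P. P \<noteq> 0 \<and> eval_ac P \<alpha> = 0}"
  let ?ld = "\<lambda>P :: 'a poly poly. Polynomial.degree (Polynomial.lead_coeff P)"
  have "P0 \<in> S" using assms by (simp add: S_def)
  then obtain M1 where M1: "M1 \<in> S" "\<And>Q. Q \<in> S \<Longrightarrow> Polynomial.degree M1 \<le> Polynomial.degree Q"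
    using ex_has_least_nat[of "\<lambda>P. P \<in> S" P0 Polynomial.degree] by blast
  obtain M2 where M2: "M2 \<in> S" "Polynomial.degree M2 = Polynomial.degree M1"
      "\<And>Q. Q \<in> S \<Longrightarrow> Polynomial.degree Q = Polynomial.degree M1 \<Longrightarrow> ?ld M2 \<le> ?ld Q"
    using ex_has_least_nat[of "\<lambda>P. P \<in> S \<and> Polynomial.degree P = Polynomial.degree M1" M1 ?ld] M1(1)
    by blast
  define u where "u = inverse (Polynomial.lead_coeff (Polynomial.lead_coeff M2))"
  have u: "u \<noteq> 0" using M2(1) by (simp add: u_def S_def)
  define M where "M = Polynomial.smult [:u:] M2"
  have deg: "Polynomial.degree M = Polynomial.degree M1" and ld: "?ld M = ?ld M2"
    using u by (simp_all add: M_def M2(2) lead_coeff_smult)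
  have M: "M \<noteq> 0" "eval_ac M \<alpha> = 0"
    using M2(1) u by (simp_all add: M_def S_def eval_ac_smult)
  have monic: "Polynomial.lead_coeff (Polynomial.lead_coeff M) = 1"
    using M2(1) u unfolding u_def by (simp add: M_def lead_coeff_smult u_def S_def)
  have min: "Polynomial.degree M \<le> Polynomial.degree Q" if "Q \<noteq> 0" "eval_ac Q \<alpha> = 0" for Q
    using M1(2)[of Q] that by (simp add: deg S_def)
  have min_ld: "?ld M \<le> ?ld Q"
    if "Q \<noteq> 0" "eval_ac Q \<alpha> = 0" "Polynomial.degree Q \<le> Polynomial.degree M" for Q
    unfolding ld using min[OF that(1,2)] that deg by (intro M2(3)) (auto simp: S_def)
  have smult_unit: "is_unit d" if eq: "M = Polynomial.smult d K" for d K
  proof -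
    have ne: "d \<noteq> 0" "K \<noteq> 0" using M(1) eq by auto
    hence "eval_ac K \<alpha> = 0" using M(2) eq by (simp add: eval_ac_smult)
    hence "?ld M \<le> ?ld K" using ne by (intro min_ld) (auto simp: eq)
    moreover have "?ld M = Polynomial.degree d + ?ld K"
      using ne by (simp add: eq lead_coeff_smult degree_mult_eq)
    ultimately show ?thesis using ne by (simp add: is_unit_iff_degree)
  qed
  have pos: "Polynomial.degree M > 0"
  proof (rule ccontr)
    assume "\<not> Polynomial.degree M > 0"
    then obtain c where c: "M = [:c:]" by (auto elim: degree_eq_zeroE)
    thus False using M by (simp add: eval_ac_const)
  qed
  have prim: "primitive_poly M"
    unfolding primitive_poly_def
  proof safe
    fix d assume "\<forall>i. d dvd Polynomial.coeff M i"
    hence "[:d:] dvd M" by (simp add: const_poly_dvd_iff)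
    then obtain K where "M = [:d:] * K" by (rule dvdE)
    thus "is_unit d" by (intro smult_unit[of d K]) simp
  qed
  have factor: "is_unit B" if eq: "M = A * B" and A: "eval_ac A \<alpha> = 0" for A B
  proof -
    have ne: "A \<noteq> 0" "B \<noteq> 0" using M(1) eq by auto
    have "Polynomial.degree B = 0"
      using min[OF ne(1) A] ne by (simp add: eq degree_mult_eq)
    then obtain b where b: "B = [:b:]" by (auto elim: degree_eq_zeroE)
    hence "is_unit b" using eq by (intro smult_unit[of b A]) simp
    thus ?thesis by (simp add: b is_unit_const_poly_iff)
  qed
  have irr: "Factorial_Ring.irreducible M"
  proof (rule Factorial_Ring.irreducibleI)
    show "\<not> is_unit M" using pos by (auto simp: is_unit_poly_iff)
    fix A B assume eq: "M = A * B"
    hence "eval_ac A \<alpha> = 0 \<or> eval_ac B \<alpha> = 0" using M(2) by (simp add: eval_ac_mult)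
    thus "is_unit A \<or> is_unit B" using factor[of A B] factor[of B A] eq by (auto simp: mult.commute)
  qed (rule M(1))
  have "M dvd Q" if Q: "eval_ac Q \<alpha> = 0" for Q
  proof -
    \<comment> \<open>Division with remainder works only after multiplying \<open>Q\<close> by some
      \<open>a\<close>; the remainder vanishes by minimality, and Gauss's lemma removes
      \<open>a\<close>.\<close>
    obtain a q where a: "a \<noteq> 0" "Polynomial.smult a Q = M * q + pseudo_mod Q M"
      and r: "pseudo_mod Q M = 0 \<or> Polynomial.degree (pseudo_mod Q M) < Polynomial.degree M"
      using pseudo_mod[OF M(1), of Q] by blast
    have "pseudo_mod Q M = Polynomial.smult a Q - M * q" using a(2) by simp
    hence "eval_ac (pseudo_mod Q M) \<alpha> = 0"
      by (simp add: eval_ac_diff eval_ac_mult eval_ac_smult Q M(2))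
    hence "pseudo_mod Q M = 0" using r min[of "pseudo_mod Q M"] by force
    hence "M dvd Polynomial.smult a Q" using a(2) by simp
    thus ?thesis by (rule primitive_poly_dvd_smult[OF prim a(1)])
  qed
  moreover have "is_min_poly \<alpha> M"
    unfolding is_min_poly_def using pos irr prim monic M(2) by blast
  ultimately show ?thesis using that by blast
qed

text \<open>The cofactor is a unit, hence a nonzero constant of the finite field, and the two monic
  normalisations make it 1.\<close>

lemma is_min_poly_unique:
  assumes M: "is_min_poly \<alpha> M" and P: "is_min_poly \<alpha> P" and "M dvd P"
  shows "P = M"
proof -
  obtain K where K: "P = M * K" using assms(3) by (rule dvdE)
  have "\<not> is_unit M" using M by (auto simp: is_min_poly_def is_unit_poly_iff)
  hence "is_unit K"
    using P K Factorial_Ring.irreducibleD[of P M K] by (auto simp: is_min_poly_def)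
  then obtain k where k: "K = [:k:]" "is_unit k" by (auto simp: is_unit_poly_iff)
  then obtain c where c: "k = [:c:]" by (auto simp: is_unit_poly_iff)
  have "P = Polynomial.smult [:c:] M" using K k c by simp
  moreover from this have "Polynomial.lead_coeff (Polynomial.lead_coeff P) =
      c * Polynomial.lead_coeff (Polynomial.lead_coeff M)"
    by (simp add: lead_coeff_smult)
  hence "c = 1" using M P by (simp add: is_min_poly_def)
  ultimately show ?thesis by (simp flip: one_pCons)
qed

lemma min_poly_root:
  assumes "P0 \<noteq> 0" "eval_ac P0 \<alpha> = 0"
  shows "is_min_poly \<alpha> (min_poly \<alpha>)" and "min_poly \<alpha> dvd P0"
proof -
  obtain M where M: "is_min_poly \<alpha> M" "\<And>Q. eval_ac Q \<alpha> = 0 \<Longrightarrow> M dvd Q"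
    using min_poly_exists[OF assms] by blast
  have "min_poly \<alpha> = M"
    unfolding min_poly_def
  proof (rule the_equality)
    show "is_min_poly \<alpha> M" by (rule M(1))
  next
    fix P assume P: "is_min_poly \<alpha> P"
    hence "M dvd P" by (intro M(2)) (simp add: is_min_poly_def)
    thus "P = M" by (rule is_min_poly_unique[OF M(1) P])
  qed
  thus "is_min_poly \<alpha> (min_poly \<alpha>)" "min_poly \<alpha> dvd P0" using M assms(2) by simp_all
qed

text \<open>The minimal polynomial divides \<open>P\<close>, and degrees in X and in T cannot drop
  under multiplication by a nonzero polynomial. Degree and height of \<open>\<alpha>\<close> are
  thus bounded without computing its minimal polynomial.\<close>

lemma min_poly_degree_height_le:
  fixes P :: "'a::{field,finite} poly poly"
  assumes "P \<noteq> 0" "eval_ac P \<alpha> = 0"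
  shows "degree_alg \<alpha> \<le> Polynomial.degree P" and "height_alg \<alpha> \<le> height_poly P"
    and "height_alg \<alpha> \<ge> 1"
proof -
  obtain K where K: "P = min_poly \<alpha> * K" using min_poly_root(2)[OF assms] by (rule dvdE)
  hence ne: "min_poly \<alpha> \<noteq> 0" "K \<noteq> 0" using assms(1) by auto
  show "degree_alg \<alpha> \<le> Polynomial.degree P"
    unfolding degree_alg_def K using ne by (simp add: degree_mult_eq)
  have "tdeg (min_poly \<alpha>) \<le> tdeg P"
    using tdeg_mult_ge[OF ne] by (simp add: K)
  thus "height_alg \<alpha> \<le> height_poly P"
    unfolding height_alg_def using card_finite_field_gt_1[where 'a='a]
    by (simp add: height_poly_eq_tdeg ne assms(1))
  show "height_alg \<alpha> \<ge> 1"
    unfolding height_alg_def using card_finite_field_gt_1[where 'a='a]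
    by (simp add: height_poly_eq_tdeg ne ge_one_powr_ge_zero)
qed

text \<open>At height 1 the inequality defining \<open>w_n_star\<close> does not restrict the
  exponent. Such numbers are roots of finitely many polynomials and can be discarded from an
  infinite set.\<close>

lemma finite_algebraic_tdeg_0:
  "finite {\<alpha> :: 'a::{field,finite} fls alg_closure.
     \<alpha> \<in> algebraic_numbers_T \<and> degree_alg \<alpha> \<le> n \<and> tdeg (min_poly \<alpha>) = 0}"
proof (rule finite_subset)
  let ?B = "tbox (Suc n) 1 - {0} :: 'a poly poly set"
  show "finite (\<Union>P\<in>?B. {\<alpha>. eval_ac P \<alpha> = 0})"
    by (intro finite_UN_I finite_Diff card_tbox finite_roots_eval_ac) auto
  show "{\<alpha>. \<alpha> \<in> algebraic_numbers_T \<and> degree_alg \<alpha> \<le> n \<and> tdeg (min_poly \<alpha>) = 0}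
      \<subseteq> (\<Union>P\<in>?B. {\<alpha>. eval_ac P \<alpha> = 0})"
  proof safe
    fix \<alpha> :: "'a fls alg_closure"
    assume \<alpha>: "\<alpha> \<in> algebraic_numbers_T" "degree_alg \<alpha> \<le> n" "tdeg (min_poly \<alpha>) = 0"
    obtain P where "P \<noteq> 0" "eval_ac P \<alpha> = 0" by (rule algebraic_numbers_T_root[OF \<alpha>(1)])
    hence "is_min_poly \<alpha> (min_poly \<alpha>)" by (rule min_poly_root)
    hence "min_poly \<alpha> \<noteq> 0" "eval_ac (min_poly \<alpha>) \<alpha> = 0" by (auto simp: is_min_poly_def)
    moreover have "min_poly \<alpha> \<in> tbox (Suc n) 1"
      using \<alpha>(2) degree_coeff_le_tdeg[of "min_poly \<alpha>"] \<alpha>(3)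
      by (auto simp: tbox_def degree_alg_def coeff_eq_0)
    ultimately show "\<alpha> \<in> (\<Union>P\<in>?B. {\<alpha>. eval_ac P \<alpha> = 0})" by blast
  qed
qed

section \<open>The coefficient sequence of \<open>\<xi>(r, m)\<close>\<close>

text \<open>The difference of the two series starts at index \<open>r^n \<ge> n\<close> or later.
  The distance is that of the library, with base 2.\<close>

lemma tendsto_lac:
  assumes r: "r \<ge> 2" and bc: "\<And>n k. 1 \<le> k \<Longrightarrow> k < n \<Longrightarrow> b n k = c k"
  shows "(\<lambda>n. lac r (b n)) \<longlonglongrightarrow> lac r c"
proof (rule metric_LIMSEQ_I)
  fix \<epsilon> :: real assume "\<epsilon> > 0"
  then obtain N where N: "(1 / 2) ^ N < \<epsilon>" using real_arch_pow_inv[of \<epsilon> "1 / 2"] by auto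
  have "dist (lac r (b n)) (lac r c) < \<epsilon>" if "n \<ge> N" for n
  proof (cases "lac r (b n) = lac r c")
    case False
    define d where "d = fls_subdegree (lac r (b n) - lac r c)"
    have "int (r ^ n) \<le> d"
      unfolding d_def lac_diff[OF r, symmetric]
      using lac_nth_below[OF r, of n "\<lambda>k. b n k - c k"] bc False
      by (intro fls_subdegree_geI) (auto simp: lac_diff[OF r])
    moreover have "n \<le> r ^ n" using less_exp[of n] power_mono[of 2 r n] r by simp
    ultimately have "N \<le> nat d" using that by linarith
    moreover have "dist (lac r (b n)) (lac r c) = (1 / 2) ^ nat d"
      using False \<open>int (r ^ n) \<le> d\<close> order_trans[of 0 "int (r ^ n)" d]
      by (auto simp: dist_fls_def power_one_over inverse_eq_divide simp flip: d_def)
    ultimately have "dist (lac r (b n)) (lac r c) \<le> (1 / 2) ^ N"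
      by (simp add: power_decreasing)
    thus ?thesis using N by simp
  qed (use \<open>\<epsilon> > 0\<close> in simp)
  thus "\<exists>N. \<forall>n\<ge>N. dist (lac r (b n)) (lac r c) < \<epsilon>" by blast
qed

lemma lac_0: "lac r (\<lambda>_. 0) = 0"
proof (rule fls_eqI)
  fix n show "lac r (\<lambda>_. 0) $$ n = 0 $$ n"
    by (cases "n \<ge> 0") (simp_all add: lac_def)
qed

lemma lac_sum:
  assumes "r \<ge> 2"
  shows "lac r (\<lambda>k. \<Sum>i\<in>A. f i k) = (\<Sum>i\<in>A. lac r (f i))"
  by (induction A rule: infinite_finite_induct) (simp_all add: lac_add[OF assms] lac_0)

lemma lac_single:
  assumes "r \<ge> 2" "K \<ge> 1"
  shows "lac r (\<lambda>k. if k = K then 1 else 0) = fls_X ^ (r ^ K)"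
proof -
  have "lac r (\<lambda>k. if k = K then 1 else 0) =
      (\<Sum>k=1..K. fls_const (if k = K then 1 else 0) * fls_X ^ (r ^ k) :: 'a fls)"
    by (intro lac_finite assms) auto
  also have "\<dots> = (\<Sum>k=1..K. if k = K then fls_X ^ (r ^ K) else 0)"
    by (intro sum.cong) auto
  finally show ?thesis using assms(2) by simp
qed

lemma fls_abs_lac_le_1:
  fixes c :: "nat \<Rightarrow> 'a::{field,finite}"
  assumes "r \<ge> 2"
  shows "fls_abs (lac r c) \<le> 1"
proof -
  have "fls_abs (lac r c) \<le> real CARD('a) powr (- real (r ^ 0))"
    by (intro fls_abs_lac_le assms) auto
  also have "\<dots> \<le> real CARD('a) powr 0"
    using card_finite_field_gt_1[where 'a='a] by (intro powr_mono) auto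
  finally show ?thesis using card_finite_field_gt_1[where 'a='a] by simp
qed

text \<open>The parameter \<open>ty\<close> ties the locale to the coefficient field, which the
  other parameters do not mention.\<close>

locale xi_setting =
  fixes p r a :: nat and m :: "nat \<Rightarrow> nat" and ty :: "'a::{field,finite} itself"
  assumes prime_p: "Factorial_Ring.prime p" and char_p: "CHAR('a) = p"
    and r_eq: "r = p ^ a" and a_pos: "a \<ge> 1"
    and m_0: "m 0 = 1" and m_ge: "\<And>j. j \<ge> 1 \<Longrightarrow> m j \<ge> 2"
begin

lemma r_ge: "r \<ge> 2"
  using r_eq a_pos prime_ge_2_nat[OF prime_p] self_le_power[of p a] by simp

definition M :: "nat \<Rightarrow> nat" where
  "M j = (\<Prod>i\<le>j. m i)"

lemma M_0: "M 0 = 1"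
  by (simp add: M_def m_0)

lemma M_Suc: "M (Suc j) = M j * m (Suc j)"
  by (simp add: M_def)

lemma M_ge_power: "2 ^ j \<le> M j"
proof (induction j)
  case (Suc j)
  have "2 ^ j * 2 \<le> M j * m (Suc j)" using Suc m_ge[of "Suc j"] by (intro mult_le_mono) auto
  thus ?case by (simp add: M_Suc)
qed (simp add: M_0)

lemma M_gt: "j < M j"
  using less_le_trans[OF less_exp M_ge_power] .

lemma M_pos: "M j > 0"
  using M_gt[of j] by simp

lemma M_dvd_mono: "i \<le> j \<Longrightarrow> M i dvd M j"
  by (induction j rule: dec_induct) (auto simp: M_Suc)

lemma M_Suc_ge: "2 * M j \<le> M (Suc j)"
  using m_ge[of "Suc j"] by (simp add: M_Suc)

text \<open>Counts the series \<open>alpha_series r m j\<close> that contain the exponent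
  \<open>r^k\<close>. At \<open>k = 0\<close> the set is infinite and the cardinality defaults to 0,
  but \<open>lac\<close> never reads index 0.\<close>

definition N :: "nat \<Rightarrow> nat" where
  "N k = card {j. M j dvd k}"

text \<open>The \<open>M j\<close> form a divisor chain, so the counted indices form an initial
  segment.\<close>

lemma N_eq:
  assumes "M j dvd k" "\<not> M (Suc j) dvd k"
  shows "N k = Suc j"
proof -
  have "M i dvd k \<longleftrightarrow> i \<le> j" for i
    using assms M_dvd_mono[of i j] M_dvd_mono[of "Suc j" i] dvd_trans not_less_eq_eq by blast
  hence "{i. M i dvd k} = {..j}" by auto
  thus ?thesis by (simp add: N_def)
qed

text \<open>For \<open>j \<le> J\<close> subtracting \<open>M J\<close> preserves divisibility by
  \<open>M j\<close>; for larger \<open>j\<close> both sides fail, since \<open>M J\<close> divides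
  neither number.\<close>

lemma N_shift:
  assumes "\<not> M J dvd k" "M J \<le> k"
  shows "N (k - M J) = N k"
proof -
  have "M j dvd k - M J \<longleftrightarrow> M j dvd k" for j
  proof (cases "j \<le> J")
    case True
    thus ?thesis using M_dvd_mono[OF True] assms(2) by (metis dvd_diff_nat dvd_diffD)
  next
    case False
    have "\<not> M J dvd k - M J" using assms by (metis dvd_diffD dvd_refl)
    thus ?thesis using assms(1) False M_dvd_mono[of J j] dvd_trans by (meson nat_le_linear)
  qed
  thus ?thesis by (simp add: N_def)
qed

definition cf :: "nat \<Rightarrow> 'a" where
  "cf k = of_nat (N k)"

lemma of_nat_fixed: "(of_nat n :: 'a) ^ (r ^ s) = of_nat n"
proof (induction n)
  case (Suc n)
  have "(of_nat n + 1 :: 'a) ^ (r ^ s) = of_nat n ^ (r ^ s) + 1 ^ (r ^ s)"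
    using prime_p r_eq by (intro freshmans_dream'[where n = "a * s"]) (auto simp: char_p power_mult)
  thus ?case using Suc by (simp add: add.commute)
qed (use r_ge in simp)

lemma cf_fixed: "cf k ^ (r ^ s) = cf k"
  by (simp add: cf_def of_nat_fixed)

lemma alpha_series_eq:
  "alpha_series r m j = (lac r (\<lambda>k. if M j dvd k then 1 else 0) :: 'a fls)"
proof -
  let ?c = "\<lambda>k. if M j dvd k then 1 else 0 :: 'a"
  \<comment> \<open>From \<open>M j * Suc i = k < n\<close> follows \<open>i < n\<close>, so
    \<open>n\<close> terms already give all coefficients below \<open>n\<close>.\<close>
  have "(\<lambda>n. lac r (\<lambda>k. \<Sum>i<n. if k = M j * Suc i then 1 else 0)) \<longlonglongrightarrow> lac r ?c"
  proof (rule tendsto_lac[OF r_ge])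
    fix n k :: nat assume k: "1 \<le> k" "k < n"
    show "(\<Sum>i<n. if k = M j * Suc i then 1 else 0) = ?c k"
    proof (cases "M j dvd k")
      case True
      then obtain t where t: "k = M j * t" by (rule dvdE)
      then obtain i where i: "t = Suc i" using k by (cases t) auto
      have "t \<le> k" using t M_pos[of j] by simp
      hence "i < n" using i k by simp
      moreover have "(\<Sum>i'<n. if k = M j * Suc i' then 1 else 0) = (\<Sum>i'<n. if i' = i then 1 else 0 :: 'a)"
        using M_pos[of j] by (intro sum.cong) (auto simp: t i simp del: mult_Suc_right)
      ultimately show ?thesis using True by simp
    next
      case False
      hence "(if k = M j * Suc i then 1 else 0 :: 'a) = 0" for i by (auto simp del: mult_Suc_right)
      thus ?thesis using False by (simp del: mult_Suc_right)
    qed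
  qed
  also have "(\<lambda>n. lac r (\<lambda>k. \<Sum>i<n. if k = M j * Suc i then 1 else 0)) =
      (\<lambda>n. \<Sum>i<n. fls_X ^ (r_seq r m j ^ Suc i) :: 'a fls)"
  proof
    fix n
    have "fls_X ^ (r_seq r m j ^ Suc i) = (lac r (\<lambda>k. if k = M j * Suc i then 1 else 0) :: 'a fls)" for i
    proof -
      have "r_seq r m j ^ Suc i = r ^ (M j * Suc i)"
        by (simp add: r_seq_def M_def power_mult del: mult_Suc_right power_Suc)
      moreover have "M j * Suc i \<ge> 1" using M_pos[of j] by simp
      ultimately show ?thesis by (simp only: lac_single[OF r_ge])
    qed
    thus "lac r (\<lambda>k. \<Sum>i<n. if k = M j * Suc i then 1 else 0) =
        (\<Sum>i<n. fls_X ^ (r_seq r m j ^ Suc i) :: 'a fls)"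
      by (simp only: lac_sum[OF r_ge])
  qed
  finally show ?thesis
    unfolding alpha_series_def by (intro sums_unique[symmetric]) (simp only: sums_def)
qed

lemma xi_series_eq: "xi_series r m = lac r cf"
proof -
  have "(\<lambda>n. lac r (\<lambda>k. \<Sum>j<n. if M j dvd k then 1 else 0)) \<longlonglongrightarrow> lac r cf"
  proof (rule tendsto_lac[OF r_ge])
    fix n k :: nat assume k: "1 \<le> k" "k < n"
    \<comment> \<open>Since \<open>j < M j \<le> k < n\<close>, only the first \<open>n\<close>
      series reach index \<open>k\<close>.\<close>
    have "j < n" if "M j dvd k" for j
      using dvd_imp_le[OF that] k M_gt[of j] by simp
    hence "{..<n} \<inter> {j. M j dvd k} = {j. M j dvd k}" by auto
    thus "(\<Sum>j<n. if M j dvd k then 1 else 0) = cf k"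
      by (simp add: sum.If_cases cf_def N_def)
  qed
  hence "(\<lambda>j. alpha_series r m j) sums lac r cf"
    by (simp add: sums_def alpha_series_eq lac_sum[OF r_ge])
  thus ?thesis unfolding xi_series_def by (rule sums_unique[symmetric])
qed

abbreviation \<xi> :: "'a fls" where
  "\<xi> \<equiv> lac r cf"

text \<open>The shifted series has no term at \<open>M J\<close>, which would come from index 0;
  hence the guard \<open>k \<le> M J\<close>.\<close>

definition e :: "nat \<Rightarrow> nat \<Rightarrow> 'a" where
  "e J k = (if k \<le> M J then 0 else cf (k - M J)) - cf k"

lemma xi_frobenius: "\<xi> ^ (r ^ M J) - \<xi> = lac r (e J)"
  unfolding e_def lac_diff[OF r_ge]
  by (subst lac_frobenius[OF prime_p char_p r_eq a_pos cf_fixed]) simp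

lemma e_not_dvd:
  assumes "k > M J" "\<not> M J dvd k"
  shows "e J k = 0"
  using assms N_shift[of J k] by (simp add: e_def cf_def)

text \<open>The second factor leaves remainder 1 modulo \<open>m (Suc i) \<ge> 2\<close>, so the
  divisor chain stops at \<open>M i\<close>.\<close>

lemma N_M_mult_offset: "N (M i * (m (Suc i) * s + 1)) = Suc i"
proof (rule N_eq)
  have "\<not> m (Suc i) dvd m (Suc i) * s + 1"
    using m_ge[of "Suc i"] dvd_add_right_iff[of "m (Suc i)" "m (Suc i) * s" 1] by auto
  thus "\<not> M (Suc i) dvd M i * (m (Suc i) * s + 1)"
    using M_pos[of i] unfolding M_Suc by (subst nat_mult_dvd_cancel_disj) simp
qed simp

text \<open>\<open>M J\<close> is a proper divisor of \<open>M (Suc J)\<close>, so a step by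
  \<open>M J\<close> keeps divisibility by the former and destroys it for the latter.\<close>

lemma N_neighbour:
  assumes "M (Suc J) dvd k"
  shows "N (k + M J) = Suc J" and "k > 0 \<Longrightarrow> N (k - M J) = Suc J"
proof -
  have not: "\<not> M (Suc J) dvd M J"
    using M_Suc_ge[of J] M_pos[of J] by (auto dest: dvd_imp_le)
  have J: "M J dvd k" using assms M_dvd_mono[of J "Suc J"] by (auto intro: dvd_trans)
  show "N (k + M J) = Suc J"
    using not J assms by (intro N_eq) (auto simp: dvd_add_right_iff)
  assume "k > 0"
  hence "M J \<le> k" using J by (auto dest: dvd_imp_le)
  thus "N (k - M J) = Suc J"
    using not J assms by (intro N_eq) (auto dest: dvd_diffD1)
qed

text \<open>An arithmetic progression of multiples of \<open>M J\<close> at which \<open>e J\<close>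
  is nonzero. The degrees \<open>r ^ K1 J s\<close> of the truncation denominators then grow
  geometrically in \<open>s\<close>.\<close>

definition K1 :: "nat \<Rightarrow> nat \<Rightarrow> nat" where
  "K1 J s = M (Suc J) * (m (Suc (Suc J)) * s + 1)"

lemma K1_dvd: "M J dvd K1 J s"
  unfolding K1_def using M_dvd_mono[of J "Suc J"] by (auto intro: dvd_mult2)

lemma K1_gt: "M J < K1 J s" "s < K1 J s"
proof -
  have "2 * M J * 1 \<le> K1 J s"
    unfolding K1_def by (intro mult_le_mono M_Suc_ge) auto
  thus "M J < K1 J s" using M_pos[of J] by simp
  have "1 * (1 * s + 1) \<le> K1 J s"
    unfolding K1_def using M_pos[of "Suc J"] m_ge[of "Suc (Suc J)"]
    by (intro mult_le_mono add_le_mono) auto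
  thus "s < K1 J s" by simp
qed

lemma strict_mono_K1: "strict_mono (K1 J)"
  unfolding K1_def using M_pos[of "Suc J"] m_ge[of "Suc (Suc J)"]
  by (intro strict_monoI) simp

text \<open>\<open>N\<close> is \<open>J + 2\<close> here and \<open>J + 1\<close> one shift
  earlier, so the coefficient is -1 in every characteristic.\<close>

lemma e_K1: "e J (K1 J s) \<noteq> 0"
proof -
  have "N (K1 J s) = Suc (Suc J)" unfolding K1_def by (rule N_M_mult_offset)
  moreover have "N (K1 J s - M J) = Suc J"
    using K1_gt[of J s] by (intro N_neighbour(2)) (auto simp: K1_def)
  ultimately have "e J (K1 J s) = - 1"
    using K1_gt(1)[of J s] by (simp add: e_def cf_def)
  thus ?thesis by simp
qed

text \<open>Positions followed by a gap of length \<open>3 M\<^sub>J\<close>: around a \<open>k\<close> with \<open>N k = J + p + 1\<close> the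
  values \<open>N (k - M\<^sub>J) = N (k + M\<^sub>J) = J + 1\<close> agree with \<open>N k\<close> modulo \<open>p\<close>.\<close>

definition K2 :: "nat \<Rightarrow> nat \<Rightarrow> nat" where
  "K2 J s = M (J + p) * (m (Suc (J + p)) * s + 1) - M J"

lemma K2_ge: "M J \<le> K2 J s" "s \<le> K2 J s"
proof -
  define k where "k = M (J + p) * (m (Suc (J + p)) * s + 1)"
  have p: "p \<ge> 2" by (rule prime_ge_2_nat[OF prime_p])
  have "4 * M J \<le> 2 * M (Suc J)" using M_Suc_ge[of J] by simp
  also have "\<dots> \<le> M (Suc (Suc J))" by (rule M_Suc_ge)
  also have "\<dots> \<le> M (J + p)"
    using p M_pos[of "J + p"] M_dvd_mono[of "Suc (Suc J)" "J + p"] by (auto intro: dvd_imp_le)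
  finally have M4: "4 * M J \<le> M (J + p)" .
  have "4 * M J * (s + 1) \<le> k"
    unfolding k_def using M4 m_ge[of "Suc (J + p)"] mult_le_mono1[of 1 "m (Suc (J + p))" s]
    by (intro mult_le_mono) auto
  moreover have "s \<le> M J * s" using M_pos[of J] by simp
  moreover have "4 * M J * (s + 1) = 4 * (M J * s) + 4 * M J" by (simp add: algebra_simps)
  ultimately have "2 * M J + s \<le> k" by linarith
  thus "M J \<le> K2 J s" "s \<le> K2 J s"
    unfolding K2_def k_def[symmetric] by simp_all
qed

lemma e_K2_gap:
  assumes "K2 J s < k" "k < K2 J s + 3 * M J"
  shows "e J k = 0"
proof (cases "M J dvd k")
  case False
  thus ?thesis using K2_ge(1)[of J s] assms by (intro e_not_dvd) auto
next
  case True
  define k0 where "k0 = M (J + p) * (m (Suc (J + p)) * s + 1)"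
  have p: "p \<ge> 2" by (rule prime_ge_2_nat[OF prime_p])
  have dvd: "M (Suc J) dvd k0" "M J dvd k0"
    unfolding k0_def using p by (intro dvd_mult2 M_dvd_mono; simp)+
  have k0: "K2 J s = k0 - M J" by (simp add: K2_def k0_def)
  hence "k0 \<ge> 2 * M J" using K2_ge(1)[of J s] M_pos[of J] by linarith
  obtain l l0 where l: "k = M J * l" "k0 = M J * l0" using True dvd(2) by (auto elim!: dvdE)
  \<comment> \<open>Strictly between \<open>k0 - M J\<close> and \<open>k0 + 2 * M J\<close> the
    only multiples of \<open>M J\<close> are \<open>k0\<close> and \<open>k0 + M J\<close>.\<close>
  have "M J * (l0 - 1) < M J * l" "M J * l < M J * (l0 + 2)"
    using assms l k0 \<open>k0 \<ge> 2 * M J\<close> by (auto simp: algebra_simps)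
  hence "l0 - 1 < l" "l < l0 + 2" using mult_less_cancel1 by metis+
  hence "l = l0 \<or> l = l0 + 1" by linarith
  hence "k = k0 \<or> k = k0 + M J" using l by auto
  moreover have "N k0 = J + p + 1" using N_M_mult_offset[of "J + p" s] by (simp add: k0_def)
  moreover have "N (k0 - M J) = J + 1" "N (k0 + M J) = J + 1"
    using N_neighbour[OF dvd(1)] M_pos[of J] \<open>k0 \<ge> 2 * M J\<close> by simp_all
  moreover have "(of_nat (J + p + 1) :: 'a) = of_nat (J + 1)"
    using of_nat_CHAR[where 'a='a] by (simp add: char_p)
  ultimately show ?thesis
    using \<open>k0 \<ge> 2 * M J\<close> M_pos[of J] by (auto simp: e_def cf_def simp del: of_nat_add of_nat_Suc)
qed

end

section \<open>Lower bounds for values of polynomials at \<open>\<xi>\<close>\<close>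

lemma eval_fls_mult: "eval_fls (P * Q) x = eval_fls P x * eval_fls Q x"
  by (simp add: eval_fls_def of_Tpoly.map_poly_mult)

lemma tbox_degree: "P \<in> tbox (Suc n) t \<Longrightarrow> Polynomial.degree P \<le> n"
  by (intro degree_le) (auto simp: tbox_def)

lemma fls_abs_power_le_1: "fls_abs x \<le> 1 \<Longrightarrow> fls_abs (x ^ i) \<le> 1"
  by (simp add: fls_abs_power power_le_one)

lemma fls_abs_coeff_tbox:
  fixes P :: "'a::{field,finite} poly poly"
  assumes "P \<in> tbox d t"
  shows "fls_abs (of_Tpoly (Polynomial.coeff P i)) \<le> real CARD('a) powr real t"
  using assms by (intro fls_abs_of_Tpoly_le) (auto simp: tbox_def)

lemma fls_abs_eval_le:
  fixes P :: "'a::{field,finite} poly poly"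
  assumes "P \<in> tbox d t" "fls_abs x \<le> 1"
  shows "fls_abs (eval_fls P x) \<le> real CARD('a) powr real t"
  unfolding eval_fls_def of_Tpoly.eval_eq_sum[OF order.refl]
proof (rule fls_abs_sum_le)
  fix i
  have "fls_abs (of_Tpoly (Polynomial.coeff P i)) * fls_abs (x ^ i) \<le> real CARD('a) powr real t * 1"
    using fls_abs_coeff_tbox[OF assms(1)] fls_abs_power_le_1[OF assms(2)] by (intro mult_mono) auto
  thus "fls_abs (of_Tpoly (Polynomial.coeff P i) * x ^ i) \<le> real CARD('a) powr real t"
    by (simp add: fls_abs_mult)
qed simp

text \<open>Telescoping; by the ultrametric inequality no factor depending on \<open>i\<close>
  appears.\<close>

lemma fls_abs_power_diff_le:
  assumes "fls_abs x \<le> 1" "fls_abs y \<le> 1"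
  shows "fls_abs (x ^ i - y ^ i) \<le> fls_abs (x - y)"
proof (induction i)
  case (Suc i)
  have "fls_abs (x * (x ^ i - y ^ i)) \<le> 1 * fls_abs (x - y)"
    unfolding fls_abs_mult using assms Suc by (intro mult_mono) auto
  moreover have "fls_abs ((x - y) * y ^ i) \<le> fls_abs (x - y) * 1"
    unfolding fls_abs_mult using fls_abs_power_le_1[OF assms(2)] by (intro mult_mono) auto
  ultimately have "fls_abs (x * (x ^ i - y ^ i) + (x - y) * y ^ i) \<le> fls_abs (x - y)"
    by (intro fls_abs_add_le) simp_all
  thus ?case by (simp add: algebra_simps)
qed simp

lemma fls_abs_eval_diff_le:
  fixes P :: "'a::{field,finite} poly poly"
  assumes "P \<in> tbox d t" "fls_abs x \<le> 1" "fls_abs y \<le> 1"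
  shows "fls_abs (eval_fls P x - eval_fls P y) \<le> real CARD('a) powr real t * fls_abs (x - y)"
proof -
  have "eval_fls P x - eval_fls P y =
      (\<Sum>i\<le>Polynomial.degree P. of_Tpoly (Polynomial.coeff P i) * (x ^ i - y ^ i))"
    unfolding eval_fls_def of_Tpoly.eval_eq_sum[OF order.refl]
    by (simp add: right_diff_distrib sum_subtractf)
  also have "fls_abs \<dots> \<le> real CARD('a) powr real t * fls_abs (x - y)"
    using fls_abs_coeff_tbox[OF assms(1)] fls_abs_power_diff_le[OF assms(2,3)]
    by (intro fls_abs_sum_le) (auto simp: fls_abs_mult intro!: mult_mono)
  finally show ?thesis .
qed

text \<open>Liouville's argument: multiplication by \<open>T^(D * n)\<close> clears all
  denominators, and a nonzero polynomial in T has absolute value at least 1.\<close>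

lemma eval_fls_integral:
  fixes P :: "'a::{field,finite} poly poly"
  assumes "fls_X_inv ^ D * y = of_Tpoly c" "Polynomial.degree P \<le> n" "eval_fls P y \<noteq> 0"
  shows "fls_abs (eval_fls P y) \<ge> real CARD('a) powr (- real (D * n))"
proof -
  define T :: "'a poly" where "T = Polynomial.monom 1 1"
  have T: "of_Tpoly T = fls_X_inv" by (simp add: T_def of_Tpoly_monom)
  have "fls_X_inv ^ (D * n) * (of_Tpoly (Polynomial.coeff P i) * y ^ i) =
      of_Tpoly (Polynomial.coeff P i * c ^ i * T ^ (D * (n - i)))" if "i \<le> n" for i
  proof -
    have "D * n = D * i + D * (n - i)" using that by (simp flip: add_mult_distrib2)
    hence "fls_X_inv ^ (D * n) = (fls_X_inv ^ D) ^ i * (fls_X_inv :: 'a fls) ^ (D * (n - i))"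
      by (simp add: power_add power_mult)
    moreover have "(fls_X_inv ^ D) ^ i * y ^ i = of_Tpoly (c ^ i)"
      by (simp add: assms(1) of_Tpoly.power flip: power_mult_distrib)
    ultimately show ?thesis
      by (simp add: of_Tpoly.mult of_Tpoly.power T mult_ac)
  qed
  hence "fls_X_inv ^ (D * n) * eval_fls P y =
      of_Tpoly (\<Sum>i\<le>n. Polynomial.coeff P i * c ^ i * T ^ (D * (n - i)))" (is "_ = of_Tpoly ?S")
    unfolding eval_fls_def of_Tpoly.eval_eq_sum[OF assms(2)]
    by (simp add: sum_distrib_left of_Tpoly.sum)
  moreover from this have "?S \<noteq> 0" using assms(3) by (metis fls_X_inv_pow_nonzero mult_eq_0_iff of_Tpoly_eq_0_iff)
  ultimately have "fls_abs (fls_X_inv ^ (D * n) * eval_fls P y) \<ge> 1"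
    using fls_abs_of_Tpoly_ge_1 by metis
  thus ?thesis
    using card_finite_field_gt_1[where 'a='a]
    by (simp add: fls_abs_mult fls_abs_X_inv_power powr_minus field_simps)
qed

lemma eval_fls_pcompose_frobenius:
  "eval_fls (pcompose F (map_poly (\<lambda>a. [:a:]) (Polynomial.monom 1 R - Polynomial.monom 1 1))) x =
     eval_fls F (x ^ R - x)"
proof -
  have eq: "map_poly of_Tpoly (map_poly (\<lambda>a. [:a:]) (Polynomial.monom 1 R - Polynomial.monom 1 1)) =
      Polynomial.monom 1 R - Polynomial.monom 1 1"
    by (simp add: const_poly.map_poly_diff of_Tpoly.map_poly_diff map_poly_monom of_Tpoly_const)
  show ?thesis unfolding eval_fls_def of_Tpoly.eval_pcompose eq by (simp add: poly_monom)
qed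

definition trunc :: "nat \<Rightarrow> (nat \<Rightarrow> 'a) \<Rightarrow> nat \<Rightarrow> 'a::zero" where
  "trunc K c k = (if k \<le> K then c k else 0)"

lemma lac_trunc_integral:
  fixes c :: "nat \<Rightarrow> 'a::{field,finite}"
  assumes "r \<ge> 2"
  obtains C where "fls_X_inv ^ (r ^ K) * lac r (trunc K c) = of_Tpoly C" "Polynomial.degree C \<le> r ^ K"
proof -
  define C where "C = (\<Sum>k=1..K. Polynomial.monom (c k) (r ^ K - r ^ k))"
  have "fls_X_inv ^ (r ^ K) * (fls_const (c k) * fls_X ^ (r ^ k)) =
      of_Tpoly (Polynomial.monom (c k) (r ^ K - r ^ k))" if "k \<in> {1..K}" for k
  proof -
    have "r ^ k \<le> r ^ K" using that assms by (intro power_increasing) auto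
    hence "fls_X_inv ^ (r ^ K) = fls_X_inv ^ (r ^ K - r ^ k) * (fls_X_inv ^ (r ^ k) :: 'a fls)"
      by (simp flip: power_add)
    moreover have "fls_X_inv ^ (r ^ k) * fls_X ^ (r ^ k) = (1 :: 'a fls)"
      by (simp add: fls_X_inv_times_conv_shift fls_X_conv_shift_1 flip: power_mult_distrib)
    ultimately show ?thesis by (simp add: of_Tpoly_monom mult_ac)
  qed
  moreover have "lac r (trunc K c) = (\<Sum>k=1..K. fls_const (c k) * fls_X ^ (r ^ k))"
    by (subst lac_finite[OF assms, of K]) (auto simp: trunc_def)
  ultimately have "fls_X_inv ^ (r ^ K) * lac r (trunc K c) = of_Tpoly C"
    by (simp add: sum_distrib_left C_def of_Tpoly.sum)
  moreover have "Polynomial.degree C \<le> r ^ K"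
    unfolding C_def by (intro degree_sum_le) (auto intro: order_trans[OF degree_monom_le])
  ultimately show ?thesis using that by blast
qed

context xi_setting
begin

lemma diff_trunc: "lac r c - lac r (trunc K c) = lac r (\<lambda>k. if k \<le> K then 0 else c k)"
  unfolding lac_diff[OF r_ge, symmetric] trunc_def by (rule lac_cong[OF r_ge]) auto

text \<open>The positions \<open>K1 J s\<close> supply nonzero coefficients beyond every
  \<open>K\<close>; the first one after \<open>K\<close> determines the truncation error
  exactly.\<close>

lemma fls_abs_e_trunc_eq:
  obtains k where "K < k" "e J k \<noteq> 0" "\<And>i. K < i \<Longrightarrow> i < k \<Longrightarrow> e J i = 0"
    "fls_abs (lac r (e J) - lac r (trunc K (e J))) = real CARD('a) powr (- real (r ^ k))"
proof -
  have "K < K1 J K" "e J (K1 J K) \<noteq> 0" using K1_gt e_K1 by auto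
  hence ex: "\<exists>k. K < k \<and> e J k \<noteq> 0" by blast
  define k where "k = (LEAST k. K < k \<and> e J k \<noteq> 0)"
  have k: "K < k" "e J k \<noteq> 0" using LeastI_ex[OF ex] by (simp_all add: k_def)
  moreover have least: "e J i = 0" if "K < i" "i < k" for i
    using not_less_Least[of i "\<lambda>k. K < k \<and> e J k \<noteq> 0"] that by (simp add: k_def)
  moreover have "fls_abs (lac r (e J) - lac r (trunc K (e J))) = real CARD('a) powr (- real (r ^ k))"
    unfolding diff_trunc using k least by (intro fls_abs_lac_eq r_ge) auto
  ultimately show ?thesis using that by blast
qed

text \<open>For \<open>s < t\<close> the nonzero coefficient at \<open>K1 J t\<close> is dropped by
  the first truncation and kept by the second, so the two errors differ in size.\<close>

lemma trunc_K1_inj: "inj (\<lambda>s. lac r (trunc (K1 J s) (e J)))"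
proof (rule linorder_injI)
  fix s t :: nat assume "s < t"
  hence lt: "K1 J s < K1 J t" using strict_mono_K1 by (simp add: strict_monoD)
  obtain k where k: "\<And>i. K1 J s < i \<Longrightarrow> i < k \<Longrightarrow> e J i = 0"
    "fls_abs (lac r (e J) - lac r (trunc (K1 J s) (e J))) = real CARD('a) powr (- real (r ^ k))"
    using fls_abs_e_trunc_eq[of "K1 J s" J] by metis
  obtain l where l: "K1 J t < l"
    "fls_abs (lac r (e J) - lac r (trunc (K1 J t) (e J))) = real CARD('a) powr (- real (r ^ l))"
    using fls_abs_e_trunc_eq[of "K1 J t" J] by metis
  have "k \<le> K1 J t" using k(1)[of "K1 J t"] lt e_K1[of J t] by force
  hence "r ^ k < r ^ l" using l(1) r_ge by (intro power_strict_increasing) auto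
  hence "- real (r ^ l) < - real (r ^ k)" by (simp only: neg_less_iff_less of_nat_less_iff)
  hence "real CARD('a) powr (- real (r ^ l)) < real CARD('a) powr (- real (r ^ k))"
    by (rule powr_less_mono[OF _ card_finite_field_gt_1])
  thus "lac r (trunc (K1 J s) (e J)) \<noteq> lac r (trunc (K1 J t) (e J))"
    using k(2) l(2) by auto
qed

text \<open>\<open>K1 J s\<close> is a multiple of \<open>M J\<close>, and beyond it
  \<open>e J\<close> vanishes off such multiples, so the next candidate is
  \<open>K1 J s + M J\<close>.\<close>

lemma fls_abs_e_trunc_K1:
  "fls_abs (lac r (e J) - lac r (trunc (K1 J s) (e J))) \<le>
     real CARD('a) powr (- real (r ^ (K1 J s + M J)))"
  unfolding diff_trunc
proof (intro fls_abs_lac_le r_ge)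
  fix k assume k: "1 \<le> k" "k < K1 J s + M J"
  show "(if k \<le> K1 J s then 0 else e J k) = 0"
  proof (cases "k \<le> K1 J s")
    case False
    have "\<not> M J dvd k"
    proof
      assume "M J dvd k"
      hence "M J dvd k - K1 J s" using K1_dvd by (intro dvd_diff_nat)
      hence "M J \<le> k - K1 J s" using False by (intro dvd_imp_le) auto
      thus False using k M_pos[of J] by linarith
    qed
    thus ?thesis using K1_gt[of J s] False by (auto intro: e_not_dvd)
  qed simp
qed

text \<open>The \<open>n + 1\<close> truncations are distinct, so a nonzero polynomial of degree at
  most \<open>n\<close> cannot vanish at all of them.\<close>

lemma exists_nonroot_K1:
  fixes F :: "'a poly poly"
  assumes "F \<noteq> 0" "Polynomial.degree F \<le> n"
  obtains s where "s0 \<le> s" "s \<le> s0 + n" "eval_fls F (lac r (trunc (K1 J s) (e J))) \<noteq> 0"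
proof -
  let ?y = "\<lambda>s. lac r (trunc (K1 J s) (e J))"
  let ?F = "map_poly of_Tpoly F"
  have F: "?F \<noteq> 0" using assms(1) by (subst map_poly_eq_0_iff) auto
  have "card (?y ` {s0..s0 + n}) = Suc n"
    using card_image[OF inj_on_subset[OF trunc_K1_inj subset_UNIV]] by simp
  moreover have "card {y. poly ?F y = 0} \<le> n"
    using card_poly_roots_bound[OF F] map_poly_degree_leq[of of_Tpoly F] assms(2) by simp
  ultimately have "\<not> ?y ` {s0..s0 + n} \<subseteq> {y. poly ?F y = 0}"
    using card_mono[OF poly_roots_finite[OF F], of "?y ` {s0..s0 + n}"] by linarith
  then obtain s where "s \<in> {s0..s0 + n}" "poly ?F (?y s) \<noteq> 0" by blast
  thus ?thesis using that[of s] by (simp add: eval_fls_def)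
qed

text \<open>With \<open>R = r\<^bsup>M J\<^esup> > n\<close>, a multiple \<open>P G = F(X\<^sup>R - X)\<close> turns values at \<open>\<xi>\<close> into values of \<open>F\<close> at
  \<open>\<xi>\<^sup>R - \<xi>\<close>, whose truncations \<open>y\<close> have denominators \<open>T\<^sup>D\<close> and error \<open>q\<^bsup>-DR\<^esup>\<close>. Liouville's
  bound \<open>\<bar>F(y)\<bar> \<ge> q\<^bsup>-Dn\<^esup>\<close> then wins because \<open>R > n\<close>.\<close>

lemma eval_xi_lower_bound:
  obtains C :: nat where
    "\<And>P :: 'a poly poly. P \<noteq> 0 \<Longrightarrow> Polynomial.degree P \<le> n \<Longrightarrow>
       fls_abs (eval_fls P \<xi>) \<ge> real CARD('a) powr (- real (C * (tdeg P + 1)))"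
proof -
  \<comment> \<open>Any \<open>J\<close> with \<open>r ^ M J > n\<close> would do, and
    \<open>n < M n\<close>.\<close>
  define J where "J = n"
  define R where "R = r ^ M J"
  have "n < M J" unfolding J_def by (rule M_gt)
  also have "M J < r ^ M J" using r_ge by (intro less_le_trans[OF less_exp] power_mono) auto
  finally have R: "n < R" by (simp add: R_def)
  define g where "g = n * R - n + 1"
  \<comment> \<open>The ratio of the denominator degrees at consecutive \<open>s\<close>.\<close>
  define \<rho> where "\<rho> = r ^ (M (Suc J) * m (Suc (Suc J)))"
  have "M (Suc J) * m (Suc (Suc J)) > 0"
    using M_pos[of "Suc (Suc J)"] by (simp only: M_Suc[of "Suc J"])
  hence \<rho>: "\<rho> \<ge> 2" unfolding \<rho>_def using r_ge self_le_power[of r] by (meson Suc_leI le_trans one_le_numeral)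
  define B where "B = \<rho> ^ Suc n * r ^ M (Suc J)"
  define C where "C = (B * n + 1) * g"
  show ?thesis
  proof (rule that[of C])
    fix P :: "'a poly poly" assume P: "P \<noteq> 0" "Polynomial.degree P \<le> n"
    define t where "t = Suc (g * tdeg P)"
    have "Polynomial.degree (Polynomial.monom 1 R - Polynomial.monom 1 1 :: 'a poly) \<le> R"
      using R by (intro degree_diff_le order_trans[OF degree_monom_le]) auto
    then obtain F G where FG: "F \<noteq> 0" "F \<in> tbox (Suc n) t" "G \<in> tbox g t"
      "pcompose F (map_poly (\<lambda>a. [:a:]) (Polynomial.monom 1 R - Polynomial.monom 1 1)) = P * G"
      using composition_multiple_exists[OF P, of _ R] R unfolding t_def g_def by auto
    let ?E = "lac r (e J)"
    have FE: "eval_fls F ?E = eval_fls P \<xi> * eval_fls G \<xi>"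
      using arg_cong[OF FG(4), of "\<lambda>Q. eval_fls Q \<xi>"]
      unfolding eval_fls_pcompose_frobenius eval_fls_mult R_def xi_frobenius .
    have t1: "t \<ge> 1" by (simp add: t_def)
    \<comment> \<open>The scale of \<open>s\<close> is fixed by the size of \<open>F\<close>: every
      \<open>s\<close> from \<open>s0 + 1\<close> to \<open>s0 + 1 + n\<close> gives
      \<open>t < D \<le> t * B\<close>.\<close>
    obtain s0 where s0: "\<rho> ^ s0 \<le> t" "t < \<rho> ^ (s0 + 1)"
      using ex_power_ivl1[OF \<rho> t1] by blast
    obtain s where s: "s0 + 1 \<le> s" "s \<le> s0 + 1 + n"
      and Fy: "eval_fls F (lac r (trunc (K1 J s) (e J))) \<noteq> 0"
      using exists_nonroot_K1[OF FG(1) tbox_degree[OF FG(2)], of "s0 + 1" J] by metis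
    define y where "y = lac r (trunc (K1 J s) (e J))"
    define D where "D = r ^ K1 J s"
    have D_eq: "D = \<rho> ^ s * r ^ M (Suc J)"
      by (simp add: D_def K1_def \<rho>_def algebra_simps power_add flip: power_mult)
    have "\<rho> ^ (s0 + 1) * 1 \<le> D"
      unfolding D_eq using s(1) \<rho> r_ge by (intro mult_le_mono power_increasing) auto
    hence tD: "t < D" using s0(2) by linarith
    have "\<rho> ^ s \<le> \<rho> ^ (s0 + Suc n)" using s(2) \<rho> by (intro power_increasing) auto
    also have "\<dots> \<le> t * \<rho> ^ Suc n" using s0(1) unfolding power_add by (rule mult_le_mono1)
    finally have DB: "D \<le> t * B"
      unfolding D_eq B_def by (simp add: mult_le_mono1 flip: mult.assoc)
    obtain c where "fls_X_inv ^ D * y = of_Tpoly c"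
      unfolding D_def y_def using lac_trunc_integral[OF r_ge] by metis
    hence Fy_ge: "fls_abs (eval_fls F y) \<ge> real CARD('a) powr (- real (D * n))"
      using tbox_degree[OF FG(2)] Fy unfolding y_def by (rule eval_fls_integral)
    have "fls_abs (eval_fls F ?E - eval_fls F y) \<le> real CARD('a) powr real t * fls_abs (?E - y)"
      unfolding y_def by (intro fls_abs_eval_diff_le[OF FG(2)] fls_abs_lac_le_1 r_ge)
    also have "\<dots> \<le> real CARD('a) powr real t * real CARD('a) powr (- real (D * R))"
      using fls_abs_e_trunc_K1[of J s] unfolding y_def D_def R_def power_add[symmetric]
      by (intro mult_left_mono) auto
    also have "\<dots> = real CARD('a) powr (real t - real (D * R))"
      by (simp flip: powr_add)
    also have "\<dots> < real CARD('a) powr (- real (D * n))"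
    proof (rule powr_less_mono)
      have "t + D * n < D + D * n" using tD by simp
      also have "\<dots> = D * (n + 1)" by simp
      also have "\<dots> \<le> D * R" using R by (intro mult_le_mono2) simp
      finally have "real (t + D * n) < real (D * R)" by (simp only: of_nat_less_iff)
      thus "real t - real (D * R) < - real (D * n)" by simp
    qed (rule card_finite_field_gt_1)
    finally have "fls_abs (eval_fls F ?E) = fls_abs (eval_fls F y)"
      using Fy_ge by (intro fls_abs_eq_of_diff_less) simp
    hence "real CARD('a) powr (- real (D * n)) \<le> fls_abs (eval_fls P \<xi>) * fls_abs (eval_fls G \<xi>)"
      using Fy_ge FE by (simp add: fls_abs_mult)
    also have "\<dots> \<le> fls_abs (eval_fls P \<xi>) * real CARD('a) powr real t"
      by (intro mult_left_mono fls_abs_eval_le[OF FG(3)] fls_abs_lac_le_1 r_ge) simp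
    finally have le: "real CARD('a) powr (- real (D * n)) \<le> fls_abs (eval_fls P \<xi>) * real CARD('a) powr real t" .
    \<comment> \<open>The total loss is linear in \<open>t\<close>, and
      \<open>t \<le> g * (tdeg P + 1)\<close>; this explains the constant \<open>C\<close>.\<close>
    have "D * n + t \<le> t * B * n + t" using DB by simp
    also have "\<dots> = (B * n + 1) * t" by (simp add: algebra_simps)
    also have "\<dots> \<le> (B * n + 1) * (g * (tdeg P + 1))"
      unfolding t_def by (intro mult_le_mono2) (simp add: g_def)
    finally have "D * n + t \<le> C * (tdeg P + 1)" by (simp only: C_def mult.assoc)
    hence "real (D * n) + real t \<le> real (C * (tdeg P + 1))"
      by (simp only: of_nat_add[symmetric] of_nat_le_iff)
    hence "real CARD('a) powr (- real (C * (tdeg P + 1))) \<le> real CARD('a) powr (- real (D * n) - real t)"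
      using card_finite_field_gt_1[where 'a='a] by (intro powr_mono) auto
    also have "\<dots> = real CARD('a) powr (- real (D * n)) * real CARD('a) powr (- real t)"
      by (simp flip: powr_add)
    also have "\<dots> \<le> (fls_abs (eval_fls P \<xi>) * real CARD('a) powr real t) * real CARD('a) powr (- real t)"
      using le by (intro mult_right_mono) auto
    also have "\<dots> = fls_abs (eval_fls P \<xi>)"
      using card_finite_field_gt_1[where 'a='a] by (simp add: mult.assoc flip: powr_add)
    finally show "fls_abs (eval_fls P \<xi>) \<ge> real CARD('a) powr (- real (C * (tdeg P + 1)))" .
  qed
qed

end

section \<open>Finiteness of the exponents\<close>

lemma finite_polys_tdeg_0:
  "finite {P :: 'a::{field,finite} poly poly. Polynomial.degree P \<le> n \<and> tdeg P = 0}"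
proof (rule finite_subset)
  show "{P :: 'a poly poly. Polynomial.degree P \<le> n \<and> tdeg P = 0} \<subseteq> tbox (Suc n) 1"
  proof safe
    fix P :: "'a poly poly" assume "Polynomial.degree P \<le> n" "tdeg P = 0"
    thus "P \<in> tbox (Suc n) 1"
      using degree_coeff_le_tdeg[of P] by (auto simp: tbox_def coeff_eq_0)
  qed
qed (rule card_tbox)

lemma infinite_obtain_not_in:
  assumes "infinite A" "finite B"
  obtains x where "x \<in> A" "x \<notin> B"
proof -
  have "\<not> A \<subseteq> B" using assms finite_subset[of A B] by blast
  thus ?thesis using that by blast
qed

text \<open>Comparing exponents bounds \<open>w * h\<close>, and \<open>h \<ge> 1\<close> absorbs
  \<open>C\<close> and \<open>k\<close> into multiples of \<open>h\<close>. The slack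
  \<open>k\<close> carries the constant factor lost in the estimate for algebraic numbers.\<close>

lemma exponent_bound:
  fixes w b :: real and C h :: nat
  assumes "b > 1" "h \<ge> 1" "b powr (- real (C * (h + 1))) \<le> b powr (k - w * real h)" "k \<ge> 0"
  shows "w \<le> 2 * real C + k"
proof -
  have "w * real h \<le> real (C * (h + 1)) + k" using assms(1,3) by simp
  also have "\<dots> \<le> real (C * (h + h)) + k * real h"
    using assms(2,4) mult_left_mono[of 1 "real h" k] by (intro add_mono of_nat_mono mult_le_mono2) auto
  also have "\<dots> = (2 * real C + k) * real h" by (simp add: algebra_simps)
  finally show ?thesis using assms(2) by (simp add: mult_le_cancel_right)
qed

text \<open>A finite \<open>S\<close> would have a least positive value of \<open>g\<close>.\<close>

lemma infinite_if_arbitrarily_small: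
  fixes g :: "'b \<Rightarrow> real"
  assumes "\<And>\<epsilon>. \<epsilon> > 0 \<Longrightarrow> \<exists>x\<in>S. 0 < g x \<and> g x < \<epsilon>"
  shows "infinite S"
proof
  assume fin: "finite S"
  have ne: "g ` {x\<in>S. g x > 0} \<noteq> {}" using assms[of 1] by auto
  have fin': "finite (g ` {x\<in>S. g x > 0})" using fin by simp
  have "Min (g ` {x\<in>S. g x > 0}) > 0" using fin' ne by (subst Min_gr_iff) auto
  then obtain x where "x \<in> S" "0 < g x" "g x < Min (g ` {x\<in>S. g x > 0})" using assms by blast
  moreover from this have "Min (g ` {x\<in>S. g x > 0}) \<le> g x" using fin' by (intro Min_le) auto
  ultimately show False by simp
qed

lemma exists_powr_less:
  assumes "\<epsilon> > 0"
  shows "\<exists>s. real CARD('a::{field,finite}) powr (- real s) < \<epsilon>"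
proof -
  have q: "real CARD('a) > 1" by (rule card_finite_field_gt_1)
  obtain s where "(1 / real CARD('a)) ^ s < \<epsilon>"
    using real_arch_pow_inv[OF assms, of "1 / real CARD('a)"] q by auto
  moreover have "(1 / real CARD('a)) ^ s = real CARD('a) powr (- real s)"
    using q by (simp add: powr_minus powr_realpow power_one_over inverse_eq_divide)
  ultimately show ?thesis by auto
qed

lemma cube_ratio_ge:
  fixes x :: real
  assumes "x \<ge> 2"
  shows "x \<le> (x ^ 3 - 1) / x"
proof -
  have "x ^ 2 * 2 \<le> x ^ 2 * x" using assms by (intro mult_left_mono) auto
  moreover have "x ^ 2 \<ge> 1" using assms by (intro one_le_power) simp
  ultimately have "x * x \<le> x ^ 3 - 1" by (simp add: power2_eq_square power3_eq_cube)
  thus ?thesis using assms by (simp add: pos_le_divide_eq)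
qed

lemma extends_fls_absD:
  assumes "extends_fls_abs v"
  shows "v x \<ge> 0" "v 0 = 0" "v 1 = 1" "v (x * y) = v x * v y" "v (x + y) \<le> v x + v y"
    "v (to_ac z) = fls_abs z" "v (x ^ n) = v x ^ n" "v (- x) = v x"
proof -
  have *: "\<And>x. v x \<ge> 0" "\<And>x. v x = 0 \<longleftrightarrow> x = 0" "\<And>x y. v (x * y) = v x * v y"
    "\<And>x y. v (x + y) \<le> v x + v y" "\<And>x. v (to_ac x) = fls_abs x"
    using assms unfolding extends_fls_abs_def by blast+
  show "v x \<ge> 0" "v (x * y) = v x * v y" "v (x + y) \<le> v x + v y" "v (to_ac z) = fls_abs z"
    by (rule *)+
  show "v 0 = 0" by (simp only: *(2))
  show one: "v 1 = 1" using *(5)[of 1] by simp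
  show "v (x ^ n) = v x ^ n" by (induction n) (simp_all add: one *(3))
  have "v (- 1) = 1" using *(5)[of "- 1"] by simp
  thus "v (- x) = v x" using *(3)[of "- 1" x] by simp
qed

lemma extends_fls_abs_sum_le:
  assumes "extends_fls_abs v"
  shows "v (sum f A) \<le> (\<Sum>i\<in>A. v (f i))"
proof (induction A rule: infinite_finite_induct)
  case (insert x F)
  have "v (f x + sum f F) \<le> v (f x) + v (sum f F)"
    by (rule extends_fls_absD[OF assms])
  thus ?case using insert by simp
qed (simp_all add: extends_fls_absD(2)[OF assms])

text \<open>Only the triangle inequality is at hand for \<open>v\<close>, which costs a factor
  \<open>2^i\<close> that is harmless for the exponents.\<close>

lemma extends_fls_abs_power_diff_le:
  assumes v: "extends_fls_abs v" and "v x \<le> 1" "v y \<le> 2"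
  shows "v (x ^ i - y ^ i) \<le> v (x - y) * 2 ^ i"
proof (induction i)
  case 0
  show ?case by (simp add: extends_fls_absD[OF v])
next
  case (Suc i)
  note nonneg = extends_fls_absD(1)[OF v]
  have "x ^ Suc i - y ^ Suc i = x * (x ^ i - y ^ i) + (x - y) * y ^ i" by (simp add: algebra_simps)
  hence "v (x ^ Suc i - y ^ Suc i) \<le> v (x * (x ^ i - y ^ i)) + v ((x - y) * y ^ i)"
    using extends_fls_absD(5)[OF v] by metis
  also have "\<dots> = v x * v (x ^ i - y ^ i) + v (x - y) * v y ^ i"
    by (simp only: extends_fls_absD(4,7)[OF v])
  also have "\<dots> \<le> 1 * (v (x - y) * 2 ^ i) + v (x - y) * 2 ^ i"
    using assms(2,3) Suc nonneg by (intro add_mono mult_mono power_mono) auto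
  finally show ?case by simp
qed

context xi_setting
begin

lemma w_n_finite: "w_n n \<xi> < \<infinity>"
proof -
  obtain C :: nat where C: "\<And>P :: 'a poly poly. P \<noteq> 0 \<Longrightarrow> Polynomial.degree P \<le> n \<Longrightarrow>
       fls_abs (eval_fls P \<xi>) \<ge> real CARD('a) powr (- real (C * (tdeg P + 1)))"
    using eval_xi_lower_bound by blast
  have "w_n n \<xi> \<le> ereal (2 * real C + 0)"
    unfolding w_n_def
  proof (rule Sup_least, safe)
    fix w :: real
    let ?A = "{P. Polynomial.degree P \<le> n \<and> 0 < fls_abs (eval_fls P \<xi>) \<and>
                  fls_abs (eval_fls P \<xi>) \<le> height_poly P powr (- w)}"
    assume "infinite ?A"
    \<comment> \<open>Polynomials of height 1 say nothing about \<open>w\<close>; being finitely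
      many, they can be avoided.\<close>
    then obtain P where P: "P \<in> ?A" "P \<notin> {P. Polynomial.degree P \<le> n \<and> tdeg P = 0}"
      using infinite_obtain_not_in finite_polys_tdeg_0 by blast
    have "P \<noteq> 0" using P(1) by (auto simp: eval_fls_def)
    hence "real CARD('a) powr (- real (C * (tdeg P + 1))) \<le> fls_abs (eval_fls P \<xi>)"
      using P(1) by (intro C) auto
    also have "\<dots> \<le> height_poly P powr (- w)" using P(1) by simp
    also have "\<dots> = real CARD('a) powr (0 - w * real (tdeg P))"
      by (simp add: height_poly_eq_tdeg[OF \<open>P \<noteq> 0\<close>] powr_powr mult.commute)
    finally have "w \<le> 2 * real C + 0"
      using P by (intro exponent_bound[OF card_finite_field_gt_1]) auto
    thus "ereal w \<le> ereal (2 * real C + 0)" by simp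
  qed
  thus ?thesis by (rule order_le_less_trans) simp
qed

text \<open>A mean value estimate: subtracting the value 0 at \<open>\<alpha>\<close> leaves
  differences of powers. The bound on the distance ensures
  \<open>v \<alpha> \<le> 2\<close>.\<close>

lemma eval_ac_diff_bound:
  assumes v: "extends_fls_abs v" and P: "P \<noteq> 0" "Polynomial.degree P \<le> n"
    and \<alpha>: "eval_ac P \<alpha> = 0" "v (to_ac \<xi> - \<alpha>) \<le> 1"
  shows "fls_abs (eval_fls P \<xi>) \<le> height_poly P * (v (to_ac \<xi> - \<alpha>) * real (Suc n * 2 ^ n))"
proof -
  let ?h = "\<lambda>i. to_ac (of_Tpoly (Polynomial.coeff P i))"
  note v_ac = extends_fls_absD(6)[OF v]
  note nonneg = extends_fls_absD(1)[OF v]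
  have xi1: "v (to_ac \<xi>) \<le> 1" using fls_abs_lac_le_1[OF r_ge] by (simp add: v_ac)
  have "v (to_ac \<xi> + (- (to_ac \<xi> - \<alpha>))) \<le> v (to_ac \<xi>) + v (- (to_ac \<xi> - \<alpha>))"
    by (rule extends_fls_absD[OF v])
  hence "v \<alpha> \<le> 2" using xi1 \<alpha>(2) unfolding extends_fls_absD(8)[OF v] by simp
  have "fls_abs (eval_fls P \<xi>) = v (eval_ac P (to_ac \<xi>) - eval_ac P \<alpha>)"
    by (simp add: \<alpha>(1) eval_ac_to_ac v_ac)
  also have "eval_ac P (to_ac \<xi>) - eval_ac P \<alpha> = (\<Sum>i\<le>n. ?h i * (to_ac \<xi> ^ i - \<alpha> ^ i))"
    unfolding eval_ac_def ac_of_Tpoly.eval_eq_sum[OF P(2)]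
    by (simp add: right_diff_distrib sum_subtractf)
  also have "v \<dots> \<le> (\<Sum>i\<le>n. v (?h i * (to_ac \<xi> ^ i - \<alpha> ^ i)))"
    by (rule extends_fls_abs_sum_le[OF v])
  also have "\<dots> \<le> (\<Sum>i\<le>n. height_poly P * (v (to_ac \<xi> - \<alpha>) * 2 ^ n))"
  proof (rule sum_mono)
    fix i assume "i \<in> {..n}"
    have "v (?h i) \<le> height_poly P"
      unfolding v_ac height_poly_eq_tdeg[OF P(1)]
      using degree_coeff_le_tdeg[of P i] by (intro fls_abs_of_Tpoly_le) (auto simp: coeff_eq_0)
    moreover have "v (to_ac \<xi> ^ i - \<alpha> ^ i) \<le> v (to_ac \<xi> - \<alpha>) * 2 ^ n"
    proof (rule order_trans)
      show "v (to_ac \<xi> ^ i - \<alpha> ^ i) \<le> v (to_ac \<xi> - \<alpha>) * 2 ^ i"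
        by (rule extends_fls_abs_power_diff_le[OF v xi1 \<open>v \<alpha> \<le> 2\<close>])
      show "v (to_ac \<xi> - \<alpha>) * 2 ^ i \<le> v (to_ac \<xi> - \<alpha>) * 2 ^ n"
        using \<open>i \<in> {..n}\<close> nonneg by (intro mult_left_mono power_increasing) auto
    qed
    ultimately have "v (?h i) * v (to_ac \<xi> ^ i - \<alpha> ^ i) \<le> height_poly P * (v (to_ac \<xi> - \<alpha>) * 2 ^ n)"
      using nonneg by (intro mult_mono order_trans[OF nonneg]) auto
    thus "v (?h i * (to_ac \<xi> ^ i - \<alpha> ^ i)) \<le> height_poly P * (v (to_ac \<xi> - \<alpha>) * 2 ^ n)"
      by (simp only: extends_fls_absD(4)[OF v])
  qed
  also have "\<dots> = height_poly P * (v (to_ac \<xi> - \<alpha>) * real (Suc n * 2 ^ n))"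
    by (simp add: algebra_simps)
  finally show ?thesis .
qed

lemma w_n_star_finite:
  assumes v: "extends_fls_abs v"
  shows "w_n_star v n \<xi> < \<infinity>"
proof -
  obtain C :: nat where C: "\<And>P :: 'a poly poly. P \<noteq> 0 \<Longrightarrow> Polynomial.degree P \<le> n \<Longrightarrow>
       fls_abs (eval_fls P \<xi>) \<ge> real CARD('a) powr (- real (C * (tdeg P + 1)))"
    using eval_xi_lower_bound by blast
  define k where "k = Suc n * 2 ^ n"
  have q: "real CARD('a) > 1" by (rule card_finite_field_gt_1)
  \<comment> \<open>The constant factor \<open>k\<close> is bounded by a power of \<open>q\<close>,
    so that it enters the exponent.\<close>
  have "real k \<le> 2 ^ k" using less_exp[of k] by (metis less_imp_le of_nat_le_iff of_nat_numeral of_nat_power)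
  also have "\<dots> \<le> real CARD('a) ^ k" using q by (intro power_mono) auto
  finally have k: "real k \<le> real CARD('a) powr real k" using q by (simp add: powr_realpow)
  have "w_n_star v n \<xi> \<le> ereal (2 * real C + real k)"
    unfolding w_n_star_def
  proof (rule Sup_least, safe)
    fix w :: real
    let ?A = "{\<alpha>. \<alpha> \<in> algebraic_numbers_T \<and> degree_alg \<alpha> \<le> n \<and> 0 < v (to_ac \<xi> - \<alpha>) \<and>
                  v (to_ac \<xi> - \<alpha>) \<le> height_alg \<alpha> powr (- w - 1)}"
    assume inf: "infinite ?A"
    show "ereal w \<le> ereal (2 * real C + real k)"
    proof (cases "w \<ge> 0")
      \<comment> \<open>For \<open>w \<ge> 0\<close> the distance is at most 1, as the mean value
        estimate requires; for negative \<open>w\<close> the bound is trivial.\<close>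
      case True
      obtain \<alpha> where \<alpha>: "\<alpha> \<in> ?A"
        "\<alpha> \<notin> {\<alpha>. \<alpha> \<in> algebraic_numbers_T \<and> degree_alg \<alpha> \<le> n \<and> tdeg (min_poly \<alpha>) = 0}"
        by (rule infinite_obtain_not_in[OF inf finite_algebraic_tdeg_0[of n]])
      define P where "P = min_poly \<alpha>"
      obtain P0 where P0: "P0 \<noteq> 0" "eval_ac P0 \<alpha> = 0"
        using \<alpha>(1) algebraic_numbers_T_root by blast
      hence P: "P \<noteq> 0" "eval_ac P \<alpha> = 0"
        using min_poly_root(1)[OF P0] unfolding P_def by (auto simp: is_min_poly_def)
      have deg: "Polynomial.degree P \<le> n" and h: "tdeg P \<ge> 1"
        using \<alpha> by (auto simp: P_def degree_alg_def)
      have dist: "v (to_ac \<xi> - \<alpha>) \<le> real CARD('a) powr (real (tdeg P) * (- w - 1))"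
        using \<alpha>(1) by (simp add: height_alg_def height_poly_eq_tdeg P(1) powr_powr flip: P_def)
      also have "\<dots> \<le> real CARD('a) powr 0"
        using True q by (intro powr_mono mult_nonneg_nonpos) auto
      finally have dist1: "v (to_ac \<xi> - \<alpha>) \<le> 1" using q by simp
      have "real CARD('a) powr (- real (C * (tdeg P + 1))) \<le> fls_abs (eval_fls P \<xi>)"
        using P(1) deg by (rule C)
      also have "\<dots> \<le> height_poly P * (v (to_ac \<xi> - \<alpha>) * real k)"
        unfolding k_def by (rule eval_ac_diff_bound[OF v P(1) deg P(2) dist1])
      also have "\<dots> \<le> height_poly P *
          (real CARD('a) powr (real (tdeg P) * (- w - 1)) * real CARD('a) powr real k)"
        using dist k by (intro mult_left_mono mult_mono) (auto simp: height_poly_eq_tdeg P(1))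
      also have "\<dots> = real CARD('a) powr (real k - w * real (tdeg P))"
        unfolding height_poly_eq_tdeg[OF P(1)] powr_add[symmetric]
        by (rule arg_cong[of _ _ "\<lambda>x. real CARD('a) powr x"]) (simp add: algebra_simps)
      finally have "w \<le> 2 * real C + real k"
        using h by (intro exponent_bound[OF q]) auto
      thus ?thesis by simp
    next
      case False
      have "w \<le> 2 * real C + real k" 
        using False of_nat_0_le_iff[of C] of_nat_0_le_iff[of k] by linarith
      thus ?thesis by simp
    qed
  qed
  thus ?thesis by (rule order_le_less_trans) simp
qed

section \<open>Good approximations\<close>

text \<open>With \<open>D = r ^ K\<close> the height is exactly \<open>q^D\<close>: the leading
  coefficient is \<open>T^D\<close>, and the numerator of the truncated series has degree at most
  \<open>D\<close>.\<close>

lemma approx_poly: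
  assumes "R \<ge> 2"
  obtains P :: "'a poly poly" where "P \<noteq> 0" "Polynomial.degree P \<le> R"
    "height_poly P = real CARD('a) powr real (r ^ K)"
    "\<And>x. eval_fls P x = fls_X_inv ^ (r ^ K) * (x ^ R - x - lac r (trunc K c))"
proof -
  define D where "D = r ^ K"
  obtain C where C: "fls_X_inv ^ D * lac r (trunc K c) = of_Tpoly C" "Polynomial.degree C \<le> D"
    unfolding D_def by (rule lac_trunc_integral[OF r_ge])
  define T where "T = Polynomial.monom (1 :: 'a) D"
  have T: "of_Tpoly T = fls_X_inv ^ D" "Polynomial.degree T = D" "T \<noteq> 0"
    by (simp_all add: T_def of_Tpoly_monom Polynomial.degree_monom_eq)
  define P where "P = Polynomial.monom T R - Polynomial.monom T 1 - Polynomial.monom C 0"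
  have coeff: "Polynomial.coeff P i = (if i = R then T else if i = 1 then - T else if i = 0 then - C else 0)"
    for i using assms by (auto simp: P_def)
  have P: "P \<noteq> 0" using coeff[of R] T(3) by auto
  have "tdeg P = D"
  proof (rule antisym)
    show "tdeg P \<le> D" using T(2) C(2) by (intro tdeg_le) (auto simp: coeff)
    show "D \<le> tdeg P" using degree_coeff_le_tdeg[of P R] T(2) by (simp add: coeff)
  qed
  hence "height_poly P = real CARD('a) powr real D" by (simp add: height_poly_eq_tdeg[OF P])
  moreover have "Polynomial.degree P \<le> R"
    using assms by (intro degree_le) (auto simp: coeff)
  moreover have "eval_fls P x = fls_X_inv ^ D * (x ^ R - x - lac r (trunc K c))" for x
    by (simp add: eval_fls_def P_def of_Tpoly.map_poly_diff map_poly_monom poly_monom T C(1)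
        right_diff_distrib flip: C(1))
  ultimately show ?thesis using that P unfolding D_def by blast
qed

lemma power_gap: "r ^ K * (r ^ M J) ^ 3 = r ^ (K + 3 * M J)"
  by (simp only: power_add power_mult[symmetric] mult.commute[of 3])

lemma first_nonzero_after_K2:
  obtains k where "K2 J s + 3 * M J \<le> k" "e J k \<noteq> 0" "\<And>i. K2 J s < i \<Longrightarrow> i < k \<Longrightarrow> e J i = 0"
    "fls_abs (lac r (e J) - lac r (trunc (K2 J s) (e J))) = real CARD('a) powr (- real (r ^ k))"
proof -
  obtain k where k: "K2 J s < k" "e J k \<noteq> 0" "\<And>i. K2 J s < i \<Longrightarrow> i < k \<Longrightarrow> e J i = 0"
    "fls_abs (lac r (e J) - lac r (trunc (K2 J s) (e J))) = real CARD('a) powr (- real (r ^ k))"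
    by (rule fls_abs_e_trunc_eq[of "K2 J s" J]) blast
  moreover have "K2 J s + 3 * M J \<le> k" using k(1,2) e_K2_gap[of J s k] by force
  ultimately show ?thesis using that by blast
qed

lemma R_ge: "r ^ M J \<ge> 2"
  using r_ge M_pos[of J] self_le_power[of r "M J"] by simp

lemma R_ge_real: "real (r ^ M J) \<ge> 2"
  using R_ge[of J] by (metis of_nat_le_iff of_nat_numeral)

text \<open>A gap of length \<open>3 * M J\<close> multiplies the exponent \<open>r ^ K2 J s\<close>
  by the cube of \<open>r ^ M J\<close>.\<close>

lemma powr_gap_le:
  assumes "K2 J s + 3 * M J \<le> k"
  shows "real CARD('a) powr (- real (r ^ k)) \<le>
    real CARD('a) powr (- (real (r ^ K2 J s) * real (r ^ M J) ^ 3))"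
proof -
  have "r ^ K2 J s * (r ^ M J) ^ 3 \<le> r ^ k"
    unfolding power_gap using assms r_ge by (intro power_increasing) auto
  hence "real (r ^ K2 J s * (r ^ M J) ^ 3) \<le> real (r ^ k)" by (simp only: of_nat_le_iff)
  hence "- real (r ^ k) \<le> - (real (r ^ K2 J s) * real (r ^ M J) ^ 3)" by simp
  thus ?thesis using card_finite_field_gt_1[where 'a='a] by (intro powr_mono) auto
qed

lemma s_le_power_K2: "s \<le> r ^ K2 J s"
proof -
  have "s \<le> K2 J s" by (rule K2_ge)
  also have "\<dots> \<le> 2 ^ K2 J s" using less_exp[of "K2 J s"] by simp
  also have "\<dots> \<le> r ^ K2 J s" using r_ge by (intro power_mono) auto
  finally show ?thesis .
qed

lemma w_n_ge: "w_n (r ^ M J) \<xi> \<ge> ereal (real (r ^ M J) ^ 3 - 1)"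
  unfolding w_n_def
proof (rule Sup_upper, rule CollectI, intro exI conjI)
  let ?R = "r ^ M J" and ?w = "real (r ^ M J) ^ 3 - 1"
  have q: "real CARD('a) > 1" by (rule card_finite_field_gt_1)
  show "infinite {P. Polynomial.degree P \<le> ?R \<and> 0 < fls_abs (eval_fls P \<xi>) \<and>
      fls_abs (eval_fls P \<xi>) \<le> height_poly P powr (- ?w)}" (is "infinite ?S")
  proof (rule infinite_if_arbitrarily_small[where g = "\<lambda>P. fls_abs (eval_fls P \<xi>)"])
    fix \<epsilon> :: real assume "\<epsilon> > 0"
    then obtain s where s: "real CARD('a) powr (- real s) < \<epsilon>" using exists_powr_less by blast
    define D where "D = r ^ K2 J s"
    obtain k where k: "K2 J s + 3 * M J \<le> k"
      "fls_abs (lac r (e J) - lac r (trunc (K2 J s) (e J))) = real CARD('a) powr (- real (r ^ k))"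
      using first_nonzero_after_K2[of J s] by metis
    obtain P where P: "P \<noteq> 0" "Polynomial.degree P \<le> ?R" "height_poly P = real CARD('a) powr real D"
      "\<And>x. eval_fls P x = fls_X_inv ^ D * (x ^ ?R - x - lac r (trunc (K2 J s) (e J)))"
      unfolding D_def using approx_poly[OF R_ge[of J], where K = "K2 J s" and c = "e J"] by blast
    \<comment> \<open>The value at \<xi> is \<open>T^D\<close> times the truncation error, hence of
      size at most \<open>q^(D - D * R^3)\<close>, which is the height to the power
      \<open>-(R^3 - 1)\<close>.\<close>
    have eq: "fls_abs (eval_fls P \<xi>) = real CARD('a) powr real D * real CARD('a) powr (- real (r ^ k))"
      unfolding P(4) xi_frobenius fls_abs_mult k(2) fls_abs_X_inv_power ..
    also have "\<dots> \<le> real CARD('a) powr real D * real CARD('a) powr (- (real D * real ?R ^ 3))"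
      using powr_gap_le[OF k(1)] unfolding D_def by (intro mult_left_mono) auto
    also have "\<dots> = real CARD('a) powr (real D * (- ?w))"
      by (simp add: algebra_simps flip: powr_add)
    finally have le: "fls_abs (eval_fls P \<xi>) \<le> real CARD('a) powr (real D * (- ?w))" .
    have "2 ^ 3 \<le> real ?R ^ 3" using R_ge_real by (rule power_mono) simp
    hence "real D * 1 \<le> real D * ?w" by (intro mult_left_mono) auto
    moreover have "real s \<le> real D" using s_le_power_K2[of s J] by (simp add: D_def del: of_nat_power)
    ultimately have "real s \<le> real D * ?w" by linarith
    hence "real D * (- ?w) \<le> - real s" by (simp only: mult_minus_right neg_le_iff_le)
    hence "real CARD('a) powr (real D * (- ?w)) \<le> real CARD('a) powr (- real s)"
      using q by (intro powr_mono) auto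
    hence "fls_abs (eval_fls P \<xi>) < \<epsilon>" using le s by linarith
    moreover have pos: "0 < fls_abs (eval_fls P \<xi>)" unfolding eq using q by simp
    moreover have "fls_abs (eval_fls P \<xi>) \<le> height_poly P powr (- ?w)"
      using le by (simp only: P(3) powr_powr)
    ultimately show "\<exists>P\<in>?S. 0 < fls_abs (eval_fls P \<xi>) \<and> fls_abs (eval_fls P \<xi>) < \<epsilon>"
      using P(2) by blast
  qed
qed simp

text \<open>Continuing the first \<open>K\<close> coefficients of \<open>\<xi>\<close> periodically gives a root of
  \<open>X\<^sup>R - X - E\<^sub>K\<close>, where \<open>E\<^sub>K\<close> is the truncation of \<open>\<xi>\<^sup>R - \<xi>\<close> at \<open>K\<close>.\<close>

lemma periodic_approximation:
  assumes "M J \<le> K"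
  obtains \<zeta> where "\<zeta> ^ (r ^ M J) - \<zeta> = lac r (trunc K (e J))"
    "\<And>k. K < k \<Longrightarrow> e J k \<noteq> 0 \<Longrightarrow> (\<And>i. K < i \<Longrightarrow> i < k \<Longrightarrow> e J i = 0) \<Longrightarrow>
       fls_abs (\<xi> - \<zeta>) = real CARD('a) powr (- real (r ^ k))"
proof -
  \<comment> \<open>The indices from \<open>L\<close> to \<open>K\<close> form one full period of
    length \<open>M J\<close>, the last one before the cut.\<close>
  define L where "L = K - M J + 1"
  define c where "c k = cf (if k < L then k else L + (k - L) mod M J)" for k
  have c_le: "c k = cf k" if "k \<le> K" for k
  proof (cases "k < L")
    case False
    hence "k - L < M J" using that assms by (simp add: L_def)
    thus ?thesis using False by (simp add: c_def)
  qed (simp add: c_def)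
  have c_gt: "c k = c (k - M J)" if "k > K" for k
  proof -
    have L: "k - M J \<ge> L" "k \<ge> L" using that assms M_pos[of J] by (auto simp: L_def)
    hence "k - L = (k - M J - L) + M J" using that assms by linarith
    hence "(k - L) mod M J = (k - M J - L) mod M J" by (simp only: mod_add_self2)
    thus ?thesis unfolding c_def using L by (simp only: not_less[symmetric] if_False)
  qed
  have "c k ^ (r ^ M J) = c k" for k by (simp add: c_def cf_fixed)
  hence "lac r c ^ (r ^ M J) = lac r (\<lambda>k. if k \<le> M J then 0 else c (k - M J))"
    by (rule lac_frobenius[OF prime_p char_p r_eq a_pos])
  hence "lac r c ^ (r ^ M J) - lac r c = lac r (\<lambda>k. (if k \<le> M J then 0 else c (k - M J)) - c k)"
    by (simp add: lac_diff[OF r_ge])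
  also have "\<dots> = lac r (trunc K (e J))"
    using assms c_le c_gt by (intro lac_cong[OF r_ge]) (auto simp: trunc_def e_def)
  finally have root: "lac r c ^ (r ^ M J) - lac r c = lac r (trunc K (e J))" .
  have "fls_abs (\<xi> - lac r c) = real CARD('a) powr (- real (r ^ k))"
    if k: "K < k" "e J k \<noteq> 0" "\<And>i. K < i \<Longrightarrow> i < k \<Longrightarrow> e J i = 0" for k
  proof -
    \<comment> \<open>Between \<open>K\<close> and the first nonzero \<open>e J k\<close> both
      sequences repeat the value \<open>M J\<close> places earlier, so they first differ at
      \<open>k\<close>.\<close>
    have agree: "cf i = c i" if "i < k" for i
      using that
    proof (induction i rule: less_induct)
      case (less i)
      show ?case
      proof (cases "i \<le> K")
        case False
        hence "cf i = cf (i - M J)" using k(3)[of i] less.prems assms by (simp add: e_def)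
        also have "\<dots> = c (i - M J)"
          using less.prems False assms M_pos[of J] by (intro less.IH) auto
        also have "\<dots> = c i" using c_gt[of i] False by simp
        finally show ?thesis .
      qed (simp add: c_le)
    qed
    have "cf (k - M J) = c k"
      using agree[of "k - M J"] c_gt[OF k(1)] k(1) assms M_pos[of J] by simp
    hence "cf k \<noteq> c k" using k(1,2) assms by (auto simp: e_def)
    thus ?thesis
      unfolding lac_diff[OF r_ge, symmetric] using agree k(1)
      by (intro fls_abs_lac_eq r_ge) auto
  qed
  thus ?thesis using that root by blast
qed

lemma w_n_star_ge:
  assumes v: "extends_fls_abs v"
  shows "w_n_star v (r ^ M J) \<xi> \<ge> ereal (real (r ^ M J) ^ 3 - 1)"
  unfolding w_n_star_def
proof (rule Sup_upper, rule CollectI, intro exI conjI)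
  let ?R = "r ^ M J" and ?w = "real (r ^ M J) ^ 3 - 1"
  have q: "real CARD('a) > 1" by (rule card_finite_field_gt_1)
  note v_ac = extends_fls_absD(6)[OF v]
  show "infinite {\<alpha>. \<alpha> \<in> algebraic_numbers_T \<and> degree_alg \<alpha> \<le> ?R \<and> 0 < v (to_ac \<xi> - \<alpha>) \<and>
      v (to_ac \<xi> - \<alpha>) \<le> height_alg \<alpha> powr (- ?w - 1)}" (is "infinite ?S")
  proof (rule infinite_if_arbitrarily_small[where g = "\<lambda>\<alpha>. v (to_ac \<xi> - \<alpha>)"])
    fix \<epsilon> :: real assume "\<epsilon> > 0"
    then obtain s where s: "real CARD('a) powr (- real s) < \<epsilon>" using exists_powr_less by blast
    define D where "D = r ^ K2 J s"
    obtain k where k: "K2 J s + 3 * M J \<le> k" "e J k \<noteq> 0"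
      "\<And>i. K2 J s < i \<Longrightarrow> i < k \<Longrightarrow> e J i = 0"
      using first_nonzero_after_K2[of J s] by metis
    obtain P where P: "P \<noteq> 0" "Polynomial.degree P \<le> ?R" "height_poly P = real CARD('a) powr real D"
      "\<And>x. eval_fls P x = fls_X_inv ^ D * (x ^ ?R - x - lac r (trunc (K2 J s) (e J)))"
      unfolding D_def using approx_poly[OF R_ge[of J], where K = "K2 J s" and c = "e J"] by blast
    obtain \<zeta> where \<zeta>: "\<zeta> ^ ?R - \<zeta> = lac r (trunc (K2 J s) (e J))"
      "fls_abs (\<xi> - \<zeta>) = real CARD('a) powr (- real (r ^ k))"
    proof (rule periodic_approximation[OF K2_ge(1), of J s])
      fix \<zeta> assume \<zeta>: "\<zeta> ^ ?R - \<zeta> = lac r (trunc (K2 J s) (e J))"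
        "\<And>k. K2 J s < k \<Longrightarrow> e J k \<noteq> 0 \<Longrightarrow> (\<And>i. K2 J s < i \<Longrightarrow> i < k \<Longrightarrow> e J i = 0) \<Longrightarrow>
           fls_abs (\<xi> - \<zeta>) = real CARD('a) powr (- real (r ^ k))"
      have "K2 J s < k" using k(1) M_pos[of J] by simp
      thus thesis using \<zeta>(2)[OF _ k(2,3)] by (intro that[OF \<zeta>(1)])
    qed
    have root: "eval_ac P (to_ac \<zeta>) = 0" by (simp add: eval_ac_to_ac P(4) \<zeta>(1))
    have eq: "v (to_ac \<xi> - to_ac \<zeta>) = real CARD('a) powr (- real (r ^ k))"
      using v_ac[of "\<xi> - \<zeta>"] \<zeta>(2) by simp
    have le: "v (to_ac \<xi> - to_ac \<zeta>) \<le> real CARD('a) powr (- (real D * real ?R ^ 3))"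
      unfolding eq D_def by (rule powr_gap_le[OF k(1)])
    also have "\<dots> = height_poly P powr (- ?w - 1)" by (simp add: P(3) powr_powr)
    \<comment> \<open>The exponent is negative, so passing to the smaller height of the root only
      enlarges the bound.\<close>
    also have "\<dots> \<le> height_alg (to_ac \<zeta>) powr (- ?w - 1)"
      using min_poly_degree_height_le(2,3)[OF P(1) root] by (intro powr_mono2') auto
    finally have "v (to_ac \<xi> - to_ac \<zeta>) \<le> height_alg (to_ac \<zeta>) powr (- ?w - 1)" .
    moreover have "degree_alg (to_ac \<zeta>) \<le> ?R"
      using min_poly_degree_height_le(1)[OF P(1) root] P(2) by simp
    moreover have "to_ac \<zeta> \<in> algebraic_numbers_T"
      by (rule algebraic_numbers_T_I[OF P(1) root])
    moreover have "0 < v (to_ac \<xi> - to_ac \<zeta>)" unfolding eq using q by simp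
    moreover have "v (to_ac \<xi> - to_ac \<zeta>) < \<epsilon>"
    proof -
      have "1 \<le> real ?R ^ 3" using R_ge_real[of J] by (intro one_le_power) linarith
      hence "real D * 1 \<le> real D * real ?R ^ 3" by (intro mult_left_mono) auto
      moreover have "real s \<le> real D" using s_le_power_K2[of s J] by (simp add: D_def del: of_nat_power)
      ultimately have "real CARD('a) powr (- (real D * real ?R ^ 3)) \<le> real CARD('a) powr (- real s)"
        using q by (intro powr_mono) auto
      thus ?thesis using le s by linarith
    qed
    ultimately show "\<exists>\<alpha>\<in>?S. 0 < v (to_ac \<xi> - \<alpha>) \<and> v (to_ac \<xi> - \<alpha>) < \<epsilon>" by blast
  qed
qed simp

text \<open>Along \<open>n = R = r ^ M J\<close> the quotient is at least
  \<open>(R^3 - 1) / R \<ge> R \<ge> J\<close>, and the limsup along a subsequence does not exceed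
  the full one.\<close>

lemma limsup_exponent_ratio:
  fixes f :: "nat \<Rightarrow> ereal"
  assumes "\<And>J. f (r ^ M J) \<ge> ereal (real (r ^ M J) ^ 3 - 1)"
  shows "limsup (\<lambda>n. f n / ereal (real n)) = \<infinity>"
proof -
  let ?g = "\<lambda>n. f n / ereal (real n)" and ?R = "\<lambda>J. r ^ M J"
  have "M J < M (Suc J)" for J using M_Suc_ge[of J] M_pos[of J] by linarith
  hence "?R J < ?R (Suc J)" for J using r_ge by (intro power_strict_increasing) auto
  hence mono: "strict_mono ?R" by (simp add: strict_mono_Suc_iff)
  have ge: "ereal (real J) \<le> ?g (?R J)" for J
  proof -
    have R: "real (?R J) \<ge> 2" by (rule R_ge_real)
    have "real (?R J) \<le> (real (?R J) ^ 3 - 1) / real (?R J)"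
      by (rule cube_ratio_ge[OF R])
    moreover have "real J \<le> real (?R J)"
      using seq_suble[OF mono, of J] by (simp only: of_nat_le_iff)
    ultimately have "ereal (real J) \<le> ereal ((real (?R J) ^ 3 - 1) / real (?R J))"
      unfolding ereal_less_eq by linarith
    also have "\<dots> = ereal (real (?R J) ^ 3 - 1) / ereal (real (?R J))"
    proof -
      have "real (?R J) \<noteq> 0" using R by linarith
      thus ?thesis by (simp only: ereal_divide if_False)
    qed
    also have "\<dots> \<le> ?g (?R J)"
    proof (rule ereal_divide_right_mono[OF assms])
      have "0 < real (?R J)" using R by linarith
      thus "0 < ereal (real (?R J))" by (simp only: ereal_less)
    qed
    finally show ?thesis .
  qed
  have "(\<lambda>J. ?g (?R J)) \<longlonglongrightarrow> \<infinity>"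
    unfolding tendsto_PInfty
  proof
    fix x :: real
    have "\<forall>\<^sub>F J in sequentially. x < real J"
      by (rule eventually_sequentiallyI[of "nat \<lceil>x\<rceil> + 1"]) linarith
    thus "\<forall>\<^sub>F J in sequentially. ereal x < ?g (?R J)"
      using ge by (elim eventually_mono) (meson ereal_less(3) ereal_less_le less_ereal.simps(1) less_le_trans)
  qed
  hence "limsup (\<lambda>J. ?g (?R J)) = \<infinity>" by (intro lim_imp_Limsup) auto
  thus ?thesis using limsup_subseq_mono[OF mono, of ?g] by (simp add: o_def)
qed

end

section \<open>The characteristic of the field and the conclusion\<close>

lemma CHAR_of_card_prime_power:
  assumes "Factorial_Ring.prime p" "CARD('a::{field,finite}) = p ^ e"
  shows "CHAR('a) = p"
proof -
  have "CHAR('a) > 0" by (rule finite_imp_CHAR_pos) simp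
  hence "Factorial_Ring.prime CHAR('a)" by (rule prime_CHAR_semidom)
  moreover have "CHAR('a) dvd p ^ e" using CHAR_dvd_CARD[where 'a='a] assms(2) by simp
  ultimately have "CHAR('a) dvd p" by (rule Factorial_Ring.prime_dvd_power)
  thus ?thesis using \<open>Factorial_Ring.prime CHAR('a)\<close> assms(1) by (simp add: primes_dvd_imp_eq)
qed

unbundle no fps_syntax

theorem theorem2p1:
  fixes p q r a e :: nat and m :: "nat \<Rightarrow> nat" and \<xi> :: "'a::{field,finite} fls"
  assumes "Factorial_Ring.prime p"
    and "q = p ^ e" and "e \<ge> 1"
    and "CARD('a) = q"
    and "r = p ^ a" and "a \<ge> 1"
    and "m 0 = 1" and "\<forall>j\<ge>1. m j \<ge> 2"
    and "\<xi> = xi_series r m"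
  shows "T_number \<xi> \<and> (\<forall>v. extends_fls_abs v \<longrightarrow> T_star_number v \<xi>)"
proof -
  interpret xi_setting p r a m "TYPE('a)"
    using assms CHAR_of_card_prime_power[of p e, where 'a='a] by unfold_locales auto
  show ?thesis
    unfolding assms(9) xi_series_eq T_number_def T_star_number_def w_limsup_def w_star_limsup_def
    using w_n_finite w_n_star_finite w_n_ge w_n_star_ge by (auto intro!: limsup_exponent_ratio)
qed

end
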